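(* Let $\eta$ be an uncountable regular cardinal. If there is a cardinal $\kappa$ that is tall pushing up $\delta$ with closure ${<}\eta$ for some $\delta\ge\kappa$, where $\eta\le\kappa$, then $\mathrm{SULST}(\mathcal L_{\eta,\eta})$ exists and is at most $\delta$.
   Context: $\mathcal L_{\eta,\eta}$ is the infinitary logic with conjunctions/disjunctions of fewer than $\eta$ formulas and quantification over fewer than $\eta$ variables. For a cardinal $\kappa\le\delta$, $\kappa$ is tall pushing up $\delta$ with closure ${<}\lambda$ if for every $\theta>\kappa$ there is an elementary embedding $j:V\to M$ ($M$ transitive) with critical point $\kappa$, $M^{<\lambda}\subseteq M$ and $j(\delta)>\theta$. $\mathrm{SULST}(\mathcal L)$ is the least cardinal $\delta$ such that for every language $\tau$, every $\tau$-structure $M$ of size $\gamma\ge\delta$ and every cardinal $\bar\gamma>\gamma$ there is a $\tau$-structure $\bar M$ of size $\ge\bar\gamma$ with $M\prec_{\mathcal L}\bar M$. *)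

theory Defs
  imports Main "HOL-Library.Countable_Set" "HOL-Library.Equipollence"
begin

section \<open>The universe of sets\<close>

text \<open>
  A type of this class plays the role of the set-theoretic universe \<open>V\<close>: its elements are the sets,
  \<open>elts x\<close> is the collection of members of \<open>x\<close>, and classes are HOL sets over the type. Separation
  and replacement are stated for arbitrary classes and class functions, so that set-sized HOL sets
  and functions on them correspond to sets in \<open>V\<close>. With separation, the axiom of
  choice is a consequence of Hilbert choice in HOL and is therefore not listed.
\<close>

class zfc_universe =
  fixes elts :: "'a \<Rightarrow> 'a set"
  assumes extensionality: "elts x = elts y \<Longrightarrow> x = y"
    and foundation: "elts x \<noteq> {} \<Longrightarrow> \<exists>y \<in> elts x. elts y \<inter> elts x = {}"
    and pairing: "\<exists>z. elts z = {x, y}"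
    and union: "\<exists>u. elts u = (\<Union>y \<in> elts x. elts y)"
    and powerset: "\<exists>p. elts p = {y. elts y \<subseteq> elts x}"
    and infinity: "\<exists>w. (\<exists>z \<in> elts w. elts z = {}) \<and>
                       (\<forall>x \<in> elts w. \<exists>y \<in> elts w. elts y = insert x (elts x))"
    and separation: "A \<subseteq> elts x \<Longrightarrow> \<exists>y. elts y = A"
    and replacement: "\<exists>y. elts y = f ` elts x"

text \<open>The set with a given extension; only meaningful if such a set exists.\<close>

definition set_of :: "'v::zfc_universe set \<Rightarrow> 'v" where
  "set_of A = (THE x. elts x = A)"

definition opair :: "'v::zfc_universe \<Rightarrow> 'v \<Rightarrow> 'v" where
  "opair x y = set_of {set_of {x}, set_of {x, y}}"

definition restricted_graph :: "'v::zfc_universe \<Rightarrow> ('v \<Rightarrow> 'v) \<Rightarrow> 'v" where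
  "restricted_graph a f = set_of ((\<lambda>x. opair x (f x)) ` elts a)"

definition transitive_class :: "'v::zfc_universe set \<Rightarrow> bool" where
  "transitive_class M \<longleftrightarrow> (\<forall>x \<in> M. elts x \<subseteq> M)"

text \<open>
  Von Neumann ordinals and initial ordinals. For ordinals, \<open>\<alpha> < \<beta>\<close> is \<open>\<alpha> \<in> elts \<beta>\<close> and
  \<open>\<alpha> \<le> \<beta>\<close> is \<open>elts \<alpha> \<subseteq> elts \<beta>\<close>. Sizes are compared by equipollence in HOL; by separation
  and replacement, HOL bijections between sets are (graphs of) bijections in \<open>V\<close>.
\<close>

definition Ord :: "'v::zfc_universe \<Rightarrow> bool" where
  "Ord \<alpha> \<longleftrightarrow> transitive_class (elts \<alpha>) \<and> (\<forall>\<beta> \<in> elts \<alpha>. transitive_class (elts \<beta>))"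

definition Card :: "'v::zfc_universe \<Rightarrow> bool" where
  "Card \<kappa> \<longleftrightarrow> Ord \<kappa> \<and> (\<forall>\<alpha> \<in> elts \<kappa>. \<not> elts \<alpha> \<approx> elts \<kappa>)"

definition regular_card :: "'v::zfc_universe \<Rightarrow> bool" where
  "regular_card \<kappa> \<longleftrightarrow> Card \<kappa> \<and> infinite (elts \<kappa>) \<and>
     (\<forall>A \<subseteq> elts \<kappa>. (\<forall>\<beta> \<in> elts \<kappa>. \<exists>\<alpha> \<in> A. elts \<beta> \<subseteq> elts \<alpha>) \<longrightarrow> A \<approx> elts \<kappa>)"

section \<open>Elementary embeddings of the universe\<close>

datatype fo_form =
    FO_Mem nat nat
  | FO_Eq nat nat
  | FO_Neg fo_form
  | FO_And fo_form fo_form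
  | FO_Ex nat fo_form

primrec fo_sat :: "'v::zfc_universe set \<Rightarrow> (nat \<Rightarrow> 'v) \<Rightarrow> fo_form \<Rightarrow> bool" where
  "fo_sat M s (FO_Mem m n) \<longleftrightarrow> s m \<in> elts (s n)"
| "fo_sat M s (FO_Eq m n) \<longleftrightarrow> s m = s n"
| "fo_sat M s (FO_Neg \<phi>) \<longleftrightarrow> \<not> fo_sat M s \<phi>"
| "fo_sat M s (FO_And \<phi> \<psi>) \<longleftrightarrow> fo_sat M s \<phi> \<and> fo_sat M s \<psi>"
| "fo_sat M s (FO_Ex n \<phi>) \<longleftrightarrow> (\<exists>x \<in> M. fo_sat M (s(n := x)) \<phi>)"

definition elementary_embedding :: "('v::zfc_universe \<Rightarrow> 'v) \<Rightarrow> 'v set \<Rightarrow> bool" where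
  "elementary_embedding j M \<longleftrightarrow>
     range j \<subseteq> M \<and> (\<forall>\<phi> s. fo_sat UNIV s \<phi> \<longleftrightarrow> fo_sat M (j \<circ> s) \<phi>)"

definition critical_point :: "('v::zfc_universe \<Rightarrow> 'v) \<Rightarrow> 'v \<Rightarrow> bool" where
  "critical_point j \<kappa> \<longleftrightarrow> Ord \<kappa> \<and> j \<kappa> \<noteq> \<kappa> \<and> (\<forall>\<alpha> \<in> elts \<kappa>. j \<alpha> = \<alpha>)"

text \<open>Every sequence of elements of \<open>M\<close> of length less than \<open>\<rho>\<close> is itself an element of \<open>M\<close>.\<close>

definition closed_under_seqs_below :: "'v::zfc_universe \<Rightarrow> 'v set \<Rightarrow> bool" where
  "closed_under_seqs_below \<rho> M \<longleftrightarrow>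
     (\<forall>\<alpha> \<in> elts \<rho>. \<forall>f. f ` elts \<alpha> \<subseteq> M \<longrightarrow> restricted_graph \<alpha> f \<in> M)"

definition tall_pushing_up :: "'v::zfc_universe \<Rightarrow> 'v \<Rightarrow> 'v \<Rightarrow> bool" where
  "tall_pushing_up \<kappa> \<delta> \<rho> \<longleftrightarrow>
     Card \<kappa> \<and> Card \<delta> \<and> elts \<kappa> \<subseteq> elts \<delta> \<and>
     (\<forall>\<theta>. Ord \<theta> \<and> \<kappa> \<in> elts \<theta> \<longrightarrow>
        (\<exists>j M. transitive_class M \<and> elementary_embedding j M \<and> critical_point j \<kappa> \<and>
               closed_under_seqs_below \<rho> M \<and> \<theta> \<in> elts (j \<delta>)))"

section \<open>Languages and structures\<close>

text \<open>
  Languages have finitary relation and function symbols; constants are 0-ary function symbols.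
  Only the values of the arity and interpretation functions at actual symbols and, for
  interpretations, at tuples from the domain of the correct length matter.
\<close>

record 'v language =
  rel_syms :: 'v
  fun_syms :: 'v
  rel_arity :: "'v \<Rightarrow> nat"
  fun_arity :: "'v \<Rightarrow> nat"

record 'v struct =
  domain :: 'v
  rel_int :: "'v \<Rightarrow> 'v list \<Rightarrow> bool"
  fun_int :: "'v \<Rightarrow> 'v list \<Rightarrow> 'v"

definition is_structure :: "'v::zfc_universe language \<Rightarrow> 'v struct \<Rightarrow> bool" where
  "is_structure \<tau> A \<longleftrightarrow> elts (domain A) \<noteq> {} \<and>
     (\<forall>f \<in> elts (fun_syms \<tau>). \<forall>xs \<in> lists (elts (domain A)).
        length xs = fun_arity \<tau> f \<longrightarrow> fun_int A f xs \<in> elts (domain A))"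

definition substructure :: "'v::zfc_universe language \<Rightarrow> 'v struct \<Rightarrow> 'v struct \<Rightarrow> bool" where
  "substructure \<tau> A B \<longleftrightarrow> elts (domain A) \<subseteq> elts (domain B) \<and>
     (\<forall>r \<in> elts (rel_syms \<tau>). \<forall>xs \<in> lists (elts (domain A)).
        length xs = rel_arity \<tau> r \<longrightarrow> (rel_int A r xs \<longleftrightarrow> rel_int B r xs)) \<and>
     (\<forall>f \<in> elts (fun_syms \<tau>). \<forall>xs \<in> lists (elts (domain A)).
        length xs = fun_arity \<tau> f \<longrightarrow> fun_int A f xs = fun_int B f xs)"

section \<open>The logic with parameters \<open>\<eta>, \<eta>\<close>\<close>

text \<open>
  Every set may serve as a variable. Conjunctions and disjunctions are taken over families indexed
  by a class \<open>I\<close>, quantifiers bind a class \<open>X\<close> of variables; the size bounds on \<open>I\<close> and \<open>X\<close>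
  are imposed in \<open>L_form\<close> below. The values of a family outside \<open>I\<close> are irrelevant.
\<close>

datatype 'v trm = Var 'v | App 'v "'v trm list"

datatype 'v form =
    EqF "'v trm" "'v trm"
  | RelF 'v "'v trm list"
  | NegF "'v form"
  | ConjF "'v set" "'v \<Rightarrow> 'v form"
  | DisjF "'v set" "'v \<Rightarrow> 'v form"
  | ExF "'v set" "'v form"
  | AllF "'v set" "'v form"

primrec is_term :: "'v::zfc_universe language \<Rightarrow> 'v trm \<Rightarrow> bool" where
  "is_term \<tau> (Var v) \<longleftrightarrow> True"
| "is_term \<tau> (App f ts) \<longleftrightarrow>
     f \<in> elts (fun_syms \<tau>) \<and> length ts = fun_arity \<tau> f \<and> list_all id (map (is_term \<tau>) ts)"

primrec term_val :: "'v::zfc_universe struct \<Rightarrow> ('v \<Rightarrow> 'v) \<Rightarrow> 'v trm \<Rightarrow> 'v" where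
  "term_val A s (Var v) = s v"
| "term_val A s (App f ts) = fun_int A f (map (term_val A s) ts)"

primrec L_form :: "'v::zfc_universe \<Rightarrow> 'v language \<Rightarrow> 'v form \<Rightarrow> bool" where
  "L_form \<eta> \<tau> (EqF t u) \<longleftrightarrow> is_term \<tau> t \<and> is_term \<tau> u"
| "L_form \<eta> \<tau> (RelF r ts) \<longleftrightarrow>
     r \<in> elts (rel_syms \<tau>) \<and> length ts = rel_arity \<tau> r \<and> list_all (is_term \<tau>) ts"
| "L_form \<eta> \<tau> (NegF \<phi>) \<longleftrightarrow> L_form \<eta> \<tau> \<phi>"
| "L_form \<eta> \<tau> (ConjF I \<Phi>) \<longleftrightarrow> I \<prec> elts \<eta> \<and> (\<forall>i \<in> I. L_form \<eta> \<tau> (\<Phi> i))"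
| "L_form \<eta> \<tau> (DisjF I \<Phi>) \<longleftrightarrow> I \<prec> elts \<eta> \<and> (\<forall>i \<in> I. L_form \<eta> \<tau> (\<Phi> i))"
| "L_form \<eta> \<tau> (ExF X \<phi>) \<longleftrightarrow> X \<prec> elts \<eta> \<and> L_form \<eta> \<tau> \<phi>"
| "L_form \<eta> \<tau> (AllF X \<phi>) \<longleftrightarrow> X \<prec> elts \<eta> \<and> L_form \<eta> \<tau> \<phi>"

primrec L_sat :: "'v::zfc_universe struct \<Rightarrow> ('v \<Rightarrow> 'v) \<Rightarrow> 'v form \<Rightarrow> bool" where
  "L_sat A s (EqF t u) \<longleftrightarrow> term_val A s t = term_val A s u"
| "L_sat A s (RelF r ts) \<longleftrightarrow> rel_int A r (map (term_val A s) ts)"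
| "L_sat A s (NegF \<phi>) \<longleftrightarrow> \<not> L_sat A s \<phi>"
| "L_sat A s (ConjF I \<Phi>) \<longleftrightarrow> (\<forall>i \<in> I. L_sat A s (\<Phi> i))"
| "L_sat A s (DisjF I \<Phi>) \<longleftrightarrow> (\<exists>i \<in> I. L_sat A s (\<Phi> i))"
| "L_sat A s (ExF X \<phi>) \<longleftrightarrow>
     (\<exists>t. t ` X \<subseteq> elts (domain A) \<and> L_sat A (override_on s t X) \<phi>)"
| "L_sat A s (AllF X \<phi>) \<longleftrightarrow>
     (\<forall>t. t ` X \<subseteq> elts (domain A) \<longrightarrow> L_sat A (override_on s t X) \<phi>)"

definition L_elementary_sub ::
  "'v::zfc_universe \<Rightarrow> 'v language \<Rightarrow> 'v struct \<Rightarrow> 'v struct \<Rightarrow> bool" where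
  "L_elementary_sub \<eta> \<tau> A B \<longleftrightarrow> substructure \<tau> A B \<and>
     (\<forall>\<phi> s. L_form \<eta> \<tau> \<phi> \<and> range s \<subseteq> elts (domain A) \<longrightarrow> (L_sat A s \<phi> \<longleftrightarrow> L_sat B s \<phi>))"

section \<open>The strong upward Loewenheim-Skolem-Tarski number\<close>

text \<open>
  A logic enters only through its elementary substructure relation \<open>prec\<close>. As the number need not
  exist, it is described by the predicate \<open>is_SULST prec \<mu>\<close>: it exists and equals \<open>\<mu>\<close>.
\<close>

definition SULST_property ::
  "('v::zfc_universe language \<Rightarrow> 'v struct \<Rightarrow> 'v struct \<Rightarrow> bool) \<Rightarrow> 'v \<Rightarrow> bool" where
  "SULST_property prec \<delta> \<longleftrightarrow>
     (\<forall>\<tau> A \<gamma> \<gamma>'. is_structure \<tau> A \<and> Card \<gamma> \<and> elts (domain A) \<approx> elts \<gamma> \<and> elts \<delta> \<subseteq> elts \<gamma> \<and>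
                Card \<gamma>' \<and> \<gamma> \<in> elts \<gamma>' \<longrightarrow>
        (\<exists>B. is_structure \<tau> B \<and> elts \<gamma>' \<lesssim> elts (domain B) \<and> prec \<tau> A B))"

definition is_SULST ::
  "('v::zfc_universe language \<Rightarrow> 'v struct \<Rightarrow> 'v struct \<Rightarrow> bool) \<Rightarrow> 'v \<Rightarrow> bool" where
  "is_SULST prec \<mu> \<longleftrightarrow> Card \<mu> \<and> SULST_property prec \<mu> \<and>
     (\<forall>\<nu>. Card \<nu> \<and> SULST_property prec \<nu> \<longrightarrow> elts \<mu> \<subseteq> elts \<nu>)"

end

theory Submission imports Defs begin

text \<open>
  Given a structure \<open>A\<close> of size at least \<open>\<delta>\<close> and a cardinal \<open>\<gamma>'\<close>, take \<open>j : V \<rightarrow> M\<close> with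
  \<open>\<gamma>' < j \<delta>\<close>. The structure \<open>j A\<close>, read in the language of \<open>A\<close> by interpreting a symbol \<open>r\<close> as
  \<open>j (r\<^sup>A)\<close>, has size at least \<open>\<gamma>'\<close>, and \<open>j\<close> maps \<open>A\<close> elementarily into it. Indeed, by regularity of
  \<open>\<eta>\<close> all variables of a formula \<open>\<phi>\<close> are enumerated by some \<open>\<alpha> < \<eta>\<close>, so the assignments satisfying
  \<open>\<phi>\<close> in \<open>A\<close> form a set \<open>S\<^sub>\<phi>\<close> of functions \<open>\<alpha> \<rightarrow> A\<close>. By induction on \<open>\<phi>\<close>, the set \<open>j S\<^sub>\<phi>\<close> consists of
  the assignments satisfying \<open>\<phi>\<close> in \<open>j A\<close>: each connective is a first-order operation on these sets,
  families of fewer than \<open>\<eta> \<le> \<kappa>\<close> sets are mapped pointwise by \<open>j\<close>, and closure of \<open>M\<close> under short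
  sequences gives that \<open>M\<close> contains all functions \<open>\<alpha> \<rightarrow> j A\<close>. Finally \<open>j A\<close> is replaced by an isomorphic
  copy that extends \<open>A\<close>.
\<close>

section \<open>Sets\<close>

definition small :: "'v::zfc_universe set \<Rightarrow> bool" where
  "small X \<longleftrightarrow> (\<exists>x. elts x = X)"

lemma elts_inject: "elts x = elts y \<longleftrightarrow> x = y"
  using extensionality by blast

lemma elts_set_of: "small X \<Longrightarrow> elts (set_of X) = X"
  unfolding small_def set_of_def by (auto simp: elts_inject)

lemma small_elts [simp, intro]: "small (elts x)"
  by (auto simp: small_def)

lemma small_subset: "small Y \<Longrightarrow> X \<subseteq> Y \<Longrightarrow> small X"
  unfolding small_def using separation by metis

lemma small_pair [simp, intro]: "small {x, y}"
  unfolding small_def using pairing by blast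

lemma small_singleton [simp, intro]: "small {x}"
  using small_pair[of x x] by simp

lemma small_image: "small X \<Longrightarrow> small (f ` X)" for f :: "'v::zfc_universe \<Rightarrow> 'v"
  unfolding small_def using replacement[of f] by metis

text \<open>Replacement collects the sets representing the \<open>F x\<close> into one set, and the
  union axiom flattens it.\<close>

lemma small_UN:
  fixes X :: "'v::zfc_universe set" and F :: "'v \<Rightarrow> 'v set"
  assumes "small X" "\<And>x. x \<in> X \<Longrightarrow> small (F x)"
  shows "small (\<Union>x\<in>X. F x)"
proof -
  have "small ((\<lambda>x. set_of (F x)) ` X)" by (rule small_image) fact
  then obtain w where "elts w = (\<lambda>x. set_of (F x)) ` X" by (auto simp: small_def)
  moreover obtain u where "elts u = (\<Union>y\<in>elts w. elts y)" using union by blast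
  ultimately have "elts u = (\<Union>x\<in>X. F x)" using assms(2) by (auto simp: elts_set_of)
  then show ?thesis by (auto simp: small_def)
qed

lemma small_Pow: "small X \<Longrightarrow> small {y. elts y \<subseteq> X}"
  unfolding small_def using powerset by metis

lemma eq_set_of: "small X \<Longrightarrow> u = set_of X \<longleftrightarrow> elts u = X"
  using elts_set_of elts_inject by metis

lemma opair_eq_iff_elts: "p = opair x y \<longleftrightarrow> elts p = {set_of {x}, set_of {x, y}}"
  unfolding opair_def by (rule eq_set_of) simp

lemma eq_set_of_pair: "u = set_of {x, y} \<longleftrightarrow> elts u = {x, y}"
  by (rule eq_set_of) simp

lemma set_of_inject: "small X \<Longrightarrow> small Y \<Longrightarrow> set_of X = set_of Y \<longleftrightarrow> X = Y"
  by (metis elts_set_of)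

lemma opair_inject [simp]: "opair x y = opair x' y' \<longleftrightarrow> x = x' \<and> y = y'"
proof
  assume "opair x y = opair x' y'"
  then have "{set_of {x}, set_of {x, y}} = {set_of {x'}, set_of {x', y'}}"
    using opair_eq_iff_elts by metis
  then have "set_of {x} = set_of {x'} \<and> set_of {x, y} = set_of {x', y'} \<or>
      set_of {x} = set_of {x', y'} \<and> set_of {x, y} = set_of {x'}"
    by (simp only: doubleton_eq_iff)
  then have "{x} = {x'} \<and> {x, y} = {x', y'} \<or> {x} = {x', y'} \<and> {x, y} = {x'}"
    by (simp only: set_of_inject small_pair small_singleton)
  then show "x = x' \<and> y = y'" 
    by (elim disjE conjE) (simp_all add: doubleton_eq_iff, blast)
qed simp

lemma mem_irrefl: "x \<notin> elts x"
proof -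
  obtain z where z: "elts z = {x}" using pairing[of x x] by auto
  with foundation[of z] show ?thesis by auto
qed

text \<open>Take \<open>u\<close> to be the double union of \<open>a\<close>. Since \<open>u\<close>
  lies in {u} and {u} lies in \<open>opair u x\<close>, such a pair in \<open>a\<close> would put
  \<open>u\<close> into itself. Tagging with \<open>u\<close> later produces points outside a given
  domain.\<close>

lemma exists_fresh: "\<exists>u. \<forall>x. opair u x \<notin> elts a"
proof -
  have "small (\<Union>z \<in> (\<Union>y\<in>elts a. elts y). elts z)"
    by (intro small_UN small_elts)
  then obtain w where w: "elts w = (\<Union>z \<in> (\<Union>y\<in>elts a. elts y). elts z)"
    by (auto simp: small_def)
  have "opair w x \<notin> elts a" for x
  proof
    assume "opair w x \<in> elts a"
    moreover have "set_of {w} \<in> elts (opair w x)" "w \<in> elts (set_of {w})"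
      using opair_eq_iff_elts[of "opair w x"] by (auto simp: elts_set_of)
    ultimately have "w \<in> elts w" unfolding w by blast
    then show False using mem_irrefl by blast
  qed
  then show ?thesis by blast
qed

section \<open>Ordinals and cardinals\<close>

context includes cardinal_syntax
begin

lemma Ord_mem: "Ord \<alpha> \<Longrightarrow> \<beta> \<in> elts \<alpha> \<Longrightarrow> Ord \<beta>"
  unfolding Ord_def transitive_class_def by blast

lemma Ord_trans: "Ord \<alpha> \<Longrightarrow> \<beta> \<in> elts \<alpha> \<Longrightarrow> \<gamma> \<in> elts \<beta> \<Longrightarrow> \<gamma> \<in> elts \<alpha>"
  unfolding Ord_def transitive_class_def by blast

text \<open>Foundation gives a minimal element of the set of members of \<alpha> satisfying
  \<open>P\<close>, and transitivity of \<alpha> shows that nothing below it satisfies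
  \<open>P\<close>. If the set is empty, \<alpha> itself is minimal.\<close>

lemma Ord_minimal:
  assumes "Ord \<alpha>" "P \<alpha>"
  shows "\<exists>\<beta>. Ord \<beta> \<and> P \<beta> \<and> (\<forall>\<gamma>\<in>elts \<beta>. \<not> P \<gamma>)"
proof (cases "\<exists>\<gamma>\<in>elts \<alpha>. P \<gamma>")
  case True
  obtain x where x: "elts x = {\<gamma> \<in> elts \<alpha>. P \<gamma>}"
    using separation[of "{\<gamma> \<in> elts \<alpha>. P \<gamma>}" \<alpha>] by auto
  with True have "elts x \<noteq> {}" by blast
  from foundation[OF this] x obtain \<beta> where \<beta>: "\<beta> \<in> elts \<alpha>" "P \<beta>" "elts \<beta> \<inter> elts x = {}"
    by auto
  have "\<not> P \<gamma>" if "\<gamma> \<in> elts \<beta>" for \<gamma>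
    using \<beta>(3) that x Ord_trans[OF assms(1) \<beta>(1) that] by auto
  then show ?thesis using \<beta> Ord_mem[OF assms(1)] by auto
qed (use assms in auto)

lemma Ord_induct [consumes 1, case_names step]:
  assumes "Ord \<alpha>" "\<And>\<alpha>. Ord \<alpha> \<Longrightarrow> (\<And>\<beta>. \<beta> \<in> elts \<alpha> \<Longrightarrow> P \<beta>) \<Longrightarrow> P \<alpha>"
  shows "P \<alpha>"
proof (rule ccontr)
  assume "\<not> P \<alpha>"
  with Ord_minimal[of \<alpha> "\<lambda>\<alpha>. \<not> P \<alpha>"] assms(1)
  obtain \<beta> where "Ord \<beta>" "\<not> P \<beta>" "\<forall>\<gamma>\<in>elts \<beta>. P \<gamma>" by auto
  with assms(2)[of \<beta>] show False by blast
qed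

text \<open>Nested induction: if \<alpha> and \<beta> were incomparable, the induction hypotheses
  would place every member of one in the other, and extensionality would make them equal.\<close>

lemma Ord_linear: "Ord \<alpha> \<Longrightarrow> Ord \<beta> \<Longrightarrow> \<alpha> \<in> elts \<beta> \<or> \<alpha> = \<beta> \<or> \<beta> \<in> elts \<alpha>"
proof (induction \<alpha> arbitrary: \<beta> rule: Ord_induct)
  case (step \<alpha>)
  from \<open>Ord \<beta>\<close> show ?case
  proof (induction \<beta> rule: Ord_induct)
    case inner: (step \<beta>)
    show ?case
    proof (rule ccontr)
      assume neg: "\<not> ?case"
      have "elts \<alpha> \<subseteq> elts \<beta>"
        using step.IH[OF _ \<open>Ord \<beta>\<close>] neg Ord_trans[OF \<open>Ord \<alpha>\<close>] by blast
      moreover have "elts \<beta> \<subseteq> elts \<alpha>"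
        using inner.IH neg Ord_trans[OF \<open>Ord \<beta>\<close>] by blast
      ultimately show False using neg extensionality by blast
    qed
  qed
qed

lemma Ord_subset_iff:
  assumes "Ord \<alpha>" "Ord \<beta>" shows "elts \<alpha> \<subseteq> elts \<beta> \<longleftrightarrow> \<alpha> \<in> elts \<beta> \<or> \<alpha> = \<beta>"
  using Ord_linear[OF assms] Ord_trans[OF assms(2)] mem_irrefl by blast

section \<open>Ordinals as well-orders in the HOL theory of cardinals\<close>

definition mem_order :: "'v::zfc_universe \<Rightarrow> 'v rel" where
  "mem_order \<alpha> = {(x, y). x \<in> elts \<alpha> \<and> y \<in> elts \<alpha> \<and> (x \<in> elts y \<or> x = y)}"

lemma Field_mem_order [simp]: "Field (mem_order \<alpha>) = elts \<alpha>"
  by (auto simp: mem_order_def Field_def)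

lemma underS_mem_order: "Ord \<alpha> \<Longrightarrow> \<beta> \<in> elts \<alpha> \<Longrightarrow> underS (mem_order \<alpha>) \<beta> = elts \<beta>"
  using mem_irrefl Ord_trans by (auto simp: underS_def mem_order_def)

lemma Well_order_mem_order:
  assumes "Ord \<alpha>" shows "Well_order (mem_order \<alpha>)"
proof -
  have tr: "transitive_class (elts y)" if "y \<in> elts \<alpha>" for y
    using assms that by (auto simp: Ord_def)
  have "trans (mem_order \<alpha>)"
    unfolding trans_def mem_order_def using tr by (auto simp: transitive_class_def)
  moreover have "antisym (mem_order \<alpha>)"
    unfolding antisym_def mem_order_def using tr mem_irrefl
    by (auto simp: transitive_class_def)
  moreover have "refl_on (elts \<alpha>) (mem_order \<alpha>)"
    by (auto simp: refl_on_def mem_order_def)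
  moreover have "total_on (elts \<alpha>) (mem_order \<alpha>)"
    unfolding total_on_def mem_order_def using Ord_linear Ord_mem[OF assms] by auto
  moreover have "wf (mem_order \<alpha> - Id)"
  proof (rule wfI_min)
    fix x Q assume x: "(x::'a) \<in> Q"
    show "\<exists>z\<in>Q. \<forall>y. (y, z) \<in> mem_order \<alpha> - Id \<longrightarrow> y \<notin> Q"
    proof (cases "x \<in> elts \<alpha>")
      case True
      from Ord_minimal[OF Ord_mem[OF assms this], of "\<lambda>x. x \<in> Q"] x
      obtain z where "z \<in> Q" "\<forall>y\<in>elts z. y \<notin> Q" by auto
      then show ?thesis by (auto simp: mem_order_def)
    qed (use x in \<open>auto simp: mem_order_def\<close>)
  qed
  moreover have "mem_order \<alpha> \<subseteq> elts \<alpha> \<times> elts \<alpha>" by (auto simp: mem_order_def)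
  ultimately show ?thesis
    unfolding well_order_on_def linear_order_on_def partial_order_on_def preorder_on_def
      Field_mem_order
    by (intro conjI)
qed

text \<open>A proper initial segment of the order on \<alpha> consists of the members of some
  \<beta> in \<alpha>, so an isomorphism with a segment yields the size of a smaller
  ordinal.\<close>

lemma eqpoll_of_ordIso_Restr:
  assumes "Ord \<alpha>" "\<beta> \<in> elts \<alpha>"
    "r =o Restr (mem_order \<alpha>) (underS (mem_order \<alpha>) \<beta>)"
  shows "Field r \<approx> elts \<beta>"
proof -
  have "Field (Restr (mem_order \<alpha>) (elts \<beta>)) = elts \<beta>"
    using Ord_trans[OF assms(1,2)] by (auto simp: Field_def mem_order_def)
  moreover obtain f where "iso r (Restr (mem_order \<alpha>) (elts \<beta>)) f"
    using assms(3) unfolding underS_mem_order[OF assms(1,2)] ordIso_def by blast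
  ultimately show ?thesis unfolding iso_def eqpoll_def by metis
qed

text \<open>Otherwise the cardinality order of \<alpha> would be isomorphic to a proper initial
  segment, and \<alpha> would have the size of one of its members.\<close>

lemma Card_order_mem_order:
  assumes "Card \<alpha>" shows "Card_order (mem_order \<alpha>)"
proof -
  have o: "Ord \<alpha>" using assms by (simp add: Card_def)
  note wo = Well_order_mem_order[OF o]
  show ?thesis
  proof (rule ccontr)
    assume "\<not> ?thesis"
    then have "\<not> mem_order \<alpha> \<le>o |elts \<alpha>|"
      using Card_order_iff_ordLeq_card_of[of "mem_order \<alpha>"] by simp
    then have "|elts \<alpha>| <o mem_order \<alpha>"
      unfolding not_ordLeq_iff_ordLess[OF card_of_Well_order wo] .
    then obtain \<beta> where \<beta>: "\<beta> \<in> elts \<alpha>"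
      "|elts \<alpha>| =o Restr (mem_order \<alpha>) (underS (mem_order \<alpha>) \<beta>)"
      unfolding ordLess_iff_ordIso_Restr[OF wo card_of_Well_order] Field_mem_order by (rule bexE)
    from eqpoll_of_ordIso_Restr[OF o \<beta>] have "elts \<beta> \<approx> elts \<alpha>"
      unfolding Field_card_of by (rule eqpoll_sym)
    with \<beta>(1) assms show False by (simp add: Card_def)
  qed
qed

lemma card_of_mem_order: "Card \<alpha> \<Longrightarrow> |elts \<alpha>| =o mem_order \<alpha>"
  using card_of_Field_ordIso[OF Card_order_mem_order] by simp

text \<open>By Schroeder-Bernstein and comparability of sizes, \<open>A \<prec> B\<close> is the
  failure of \<open>B \<lesssim> A\<close>, and the strict order of HOL cardinals is the same
  failure.\<close>

lemma lesspoll_iff_card_of: "A \<prec> B \<longleftrightarrow> |A| <o |B|"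
proof -
  have le: "C \<lesssim> D \<longleftrightarrow> |C| \<le>o |D|" for C :: "'x set" and D :: "'y set"
    unfolding lepoll_def card_of_ordLeq ..
  have "A \<prec> B \<longleftrightarrow> \<not> B \<lesssim> A"
  proof
    assume "A \<prec> B" then show "\<not> B \<lesssim> A"
      unfolding lesspoll_def using lepoll_antisym by auto
  next
    assume n: "\<not> B \<lesssim> A"
    then have "A \<lesssim> B" unfolding le using ordLeq_total[OF card_of_Well_order card_of_Well_order, of A B] by simp
    moreover have "\<not> A \<approx> B" using n eqpoll_imp_lepoll[OF eqpoll_sym] by auto
    ultimately show "A \<prec> B" unfolding lesspoll_def by simp
  qed
  also have "\<dots> \<longleftrightarrow> |A| <o |B|"
    unfolding le by (rule not_ordLeq_iff_ordLess[OF card_of_Well_order card_of_Well_order])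
  finally show ?thesis .
qed

lemma lesspoll_iff_mem_order:
  assumes "Card \<alpha>" shows "A \<prec> elts \<alpha> \<longleftrightarrow> |A| <o mem_order \<alpha>"
  unfolding lesspoll_iff_card_of
  by (rule iffI) (erule ordLess_ordIso_trans, rule card_of_mem_order[OF assms] ordIso_symmetric[OF card_of_mem_order[OF assms]])+

text \<open>A strictly smaller well-order is isomorphic to a proper initial segment. This supplies
  the ordinals below \<eta> that index short families and enumerate variables.\<close>

lemma lesspoll_Card_eqpoll:
  assumes "Card \<alpha>" "A \<prec> elts \<alpha>" obtains \<beta> where "\<beta> \<in> elts \<alpha>" "A \<approx> elts \<beta>"
proof -
  have o: "Ord \<alpha>" using assms by (simp add: Card_def)
  have "|A| <o mem_order \<alpha>" using assms lesspoll_iff_mem_order by blast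
  then obtain \<beta> where \<beta>: "\<beta> \<in> elts \<alpha>"
    "|A| =o Restr (mem_order \<alpha>) (underS (mem_order \<alpha>) \<beta>)"
    unfolding ordLess_iff_ordIso_Restr[OF Well_order_mem_order[OF o] card_of_Well_order]
      Field_mem_order by (rule bexE)
  from eqpoll_of_ordIso_Restr[OF o \<beta>] show ?thesis unfolding Field_card_of by (rule that[OF \<beta>(1)])
qed

text \<open>A known fact about regular cardinal orders, available once \<open>regular_card\<close>
  has been matched with \<open>regularCard\<close>.\<close>

lemma regular_card_UN_lesspoll:
  assumes reg: "regular_card \<eta>" and I: "I \<prec> elts \<eta>" and F: "\<And>i. i \<in> I \<Longrightarrow> F i \<prec> elts \<eta>"
  shows "(\<Union>i\<in>I. F i) \<prec> elts \<eta>"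
proof -
  have C: "Card \<eta>" and o: "Ord \<eta>" using reg by (auto simp: regular_card_def Card_def)
  have rc: "regularCard (mem_order \<eta>)"
    unfolding regularCard_def
  proof (intro allI impI)
    fix K assume K: "K \<subseteq> Field (mem_order \<eta>) \<and> cofinal K (mem_order \<eta>)"
    \<comment> \<open>Cofinality of orders asks for a strictly larger element, that is, for
      membership between ordinals; transitivity turns it into inclusion.\<close>
    then have "\<forall>\<beta> \<in> elts \<eta>. \<exists>\<alpha> \<in> K. elts \<beta> \<subseteq> elts \<alpha>"
      unfolding cofinal_def mem_order_def Field_mem_order[unfolded mem_order_def]
      using Ord_mem[OF o] Ord_trans by blast
    then have "K \<approx> elts \<eta>" using reg K unfolding regular_card_def by simp
    then show "|K| =o mem_order \<eta>"
      unfolding eqpoll_iff_card_of_ordIso by (rule ordIso_transitive[OF _ card_of_mem_order[OF C]])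
  qed
  have ci: "Cinfinite (mem_order \<eta>)"
    using reg Card_order_mem_order[OF C] by (auto simp: cinfinite_def regular_card_def)
  have "|\<Union>i\<in>I. F i| <o mem_order \<eta>"
    by (rule card_of_UNION_ordLess_infinite_Field_regularCard[OF rc ci])
      (use I F in \<open>auto simp: lesspoll_iff_mem_order[OF C]\<close>)
  then show ?thesis unfolding lesspoll_iff_mem_order[OF C] .
qed

lemma finite_lesspoll_regular: "regular_card \<eta> \<Longrightarrow> finite A \<Longrightarrow> A \<prec> elts \<eta>"
  by (simp add: finite_lesspoll_infinite regular_card_def)

lemma regular_card_Un_lesspoll:
  assumes "regular_card \<eta>" "A \<prec> elts \<eta>" "B \<prec> elts \<eta>"
  shows "A \<union> B \<prec> elts \<eta>"
proof -
  obtain x y where xy: "x \<in> elts \<eta>" "y \<in> elts \<eta>" "x \<noteq> y"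
    using assms(1) unfolding regular_card_def
    by (metis finite.simps finite_subset insert_iff subsetI)
  have "(\<Union>i\<in>{x, y}. if i = x then A else B) \<prec> elts \<eta>"
    by (rule regular_card_UN_lesspoll[OF assms(1) finite_lesspoll_regular[OF assms(1)]])
      (use assms in auto)
  then show ?thesis using xy by (simp add: insert_commute)
qed

end

section \<open>First-order definability\<close>

text \<open>\<open>P\<close> is a predicate rather than a formula, so definability can be proved by
  closure rules. One formula must serve all transitive classes, because it is read both in the
  universe and in the target of an embedding.\<close>

definition fo_definable :: "('v::zfc_universe set \<Rightarrow> (nat \<Rightarrow> 'v) \<Rightarrow> bool) \<Rightarrow> bool" where
  "fo_definable P \<longleftrightarrow> (\<exists>\<phi>. \<forall>M s. transitive_class M \<longrightarrow> range s \<subseteq> M \<longrightarrow> fo_sat M s \<phi> = P M s)"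

lemma fo_definableI:
  "(\<And>M s. transitive_class M \<Longrightarrow> range s \<subseteq> M \<Longrightarrow> fo_sat M s \<phi> = P M s) \<Longrightarrow> fo_definable P"
  unfolding fo_definable_def by blast

lemma fo_definable_cong:
  assumes "fo_definable P"
    and "\<And>M s. transitive_class M \<Longrightarrow> range s \<subseteq> M \<Longrightarrow> P M s = Q M s"
  shows "fo_definable Q"
proof -
  from assms(1) obtain \<phi> where
    "\<forall>M s. transitive_class M \<longrightarrow> range s \<subseteq> M \<longrightarrow> fo_sat M s \<phi> = P M s"
    unfolding fo_definable_def ..
  then show ?thesis using assms(2) by (intro fo_definableI[where \<phi> = \<phi>]) simp
qed

lemma fo_definable_mem: "fo_definable (\<lambda>M s. s m \<in> elts (s n))"
  by (rule fo_definableI[where \<phi> = "FO_Mem m n"]) simp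

lemma fo_definable_eq: "fo_definable (\<lambda>M s. s m = s n)"
  by (rule fo_definableI[where \<phi> = "FO_Eq m n"]) simp

lemma fo_definable_not:
  assumes "fo_definable P" shows "fo_definable (\<lambda>M s. \<not> P M s)"
proof -
  from assms obtain \<phi> where
    "\<forall>M s. transitive_class M \<longrightarrow> range s \<subseteq> M \<longrightarrow> fo_sat M s \<phi> = P M s"
    unfolding fo_definable_def ..
  then show ?thesis by (intro fo_definableI[where \<phi> = "FO_Neg \<phi>"]) simp
qed

lemma fo_definable_conj:
  assumes "fo_definable P" "fo_definable Q" shows "fo_definable (\<lambda>M s. P M s \<and> Q M s)"
proof -
  from assms(1) obtain \<phi> where
    "\<forall>M s. transitive_class M \<longrightarrow> range s \<subseteq> M \<longrightarrow> fo_sat M s \<phi> = P M s"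
    unfolding fo_definable_def ..
  moreover from assms(2) obtain \<psi> where
    "\<forall>M s. transitive_class M \<longrightarrow> range s \<subseteq> M \<longrightarrow> fo_sat M s \<psi> = Q M s"
    unfolding fo_definable_def ..
  ultimately show ?thesis by (intro fo_definableI[where \<phi> = "FO_And \<phi> \<psi>"]) simp
qed

lemma fo_definable_disj:
  assumes "fo_definable P" "fo_definable Q" shows "fo_definable (\<lambda>M s. P M s \<or> Q M s)"
  using fo_definable_not[OF fo_definable_conj[OF assms[THEN fo_definable_not]]] by simp

lemma fo_definable_imp:
  assumes "fo_definable P" "fo_definable Q" shows "fo_definable (\<lambda>M s. P M s \<longrightarrow> Q M s)"
  using fo_definable_disj[OF fo_definable_not[OF assms(1)] assms(2)] by simp

lemma fo_definable_iff:
  assumes "fo_definable P" "fo_definable Q" shows "fo_definable (\<lambda>M s. P M s \<longleftrightarrow> Q M s)"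
  by (rule fo_definable_cong[OF fo_definable_conj[OF fo_definable_imp[OF assms]
        fo_definable_imp[OF assms(2,1)]]]) auto

text \<open>By the freshness hypothesis \<open>P M x\<close> does not depend on position
  \<open>k\<close> of the assignment, so \<open>FO_Ex k\<close> may overwrite that position.\<close>

lemma fo_definable_ex:
  assumes fresh: "\<forall>M s x y. P M x (s(k := y)) = P M x s"
    and P: "fo_definable (\<lambda>M s. P M (s k) s)"
  shows "fo_definable (\<lambda>M s. \<exists>x\<in>M. P M x s)"
proof -
  from P obtain \<phi> where \<phi>:
    "\<forall>M s. transitive_class M \<longrightarrow> range s \<subseteq> M \<longrightarrow> fo_sat M s \<phi> = P M (s k) s"
    unfolding fo_definable_def ..
  show ?thesis
  proof (rule fo_definableI[where \<phi> = "FO_Ex k \<phi>"])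
    fix M :: "'a set" and s :: "nat \<Rightarrow> 'a"
    assume M: "transitive_class M" "range s \<subseteq> M"
    have "fo_sat M (s(k := x)) \<phi> = P M x s" if "x \<in> M" for x
    proof -
      from that have "range (s(k := x)) \<subseteq> M" using that M(2) by auto
      then show ?thesis using \<phi> M(1) fresh by simp
    qed
    then show "fo_sat M s (FO_Ex k \<phi>) = (\<exists>x\<in>M. P M x s)" by simp
  qed
qed

lemma fo_definable_all:
  assumes "\<forall>M s x y. P M x (s(k := y)) = P M x s" "fo_definable (\<lambda>M s. P M (s k) s)"
  shows "fo_definable (\<lambda>M s. \<forall>x\<in>M. P M x s)"
  using fo_definable_not[OF fo_definable_ex[where P = "\<lambda>M x s. \<not> P M x s" and k = k]]
    assms fo_definable_not[OF assms(2)] by simp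

text \<open>Bounded quantifiers are absolute: a transitive class contains all members of
  \<open>s n\<close>, so relativising the quantifier changes nothing. With \<open>k\<close> equal to
  \<open>n\<close> the bound itself would be overwritten.\<close>

lemma fo_definable_bex:
  assumes fresh: "k \<noteq> n \<and> (\<forall>M s x y. P M x (s(k := y)) = P M x s)"
    and P: "fo_definable (\<lambda>M s. P M (s k) s)"
  shows "fo_definable (\<lambda>M s. \<exists>x\<in>elts (s n). P M x s)"
proof -
  have "fo_definable (\<lambda>M s. \<exists>x\<in>M. x \<in> elts (s n) \<and> P M x s)"
    by (rule fo_definable_ex[where k = k])
      (use fresh in simp, intro fo_definable_conj fo_definable_mem P)
  then show ?thesis
  proof (rule fo_definable_cong)
    fix M :: "'a set" and s :: "nat \<Rightarrow> 'a"
    assume M: "transitive_class M" "range s \<subseteq> M"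
    then have "elts (s n) \<subseteq> M" unfolding transitive_class_def by blast
    then show "(\<exists>x\<in>M. x \<in> elts (s n) \<and> P M x s) = (\<exists>x\<in>elts (s n). P M x s)" by blast
  qed
qed

lemma fo_definable_ball:
  assumes "k \<noteq> n \<and> (\<forall>M s x y. P M x (s(k := y)) = P M x s)"
    and "fo_definable (\<lambda>M s. P M (s k) s)"
  shows "fo_definable (\<lambda>M s. \<forall>x\<in>elts (s n). P M x s)"
  using fo_definable_not[OF fo_definable_bex[where P = "\<lambda>M x s. \<not> P M x s" and k = k and n = n]]
    assms fo_definable_not[OF assms(2)] by simp

text \<open>A bounded description by members. The position \<open>Suc (u + x + y)\<close> exceeds
  the three in use and is therefore fresh.\<close>

lemma fo_definable_pair: "fo_definable (\<lambda>M s. s u = set_of {s x, s y})"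
proof -
  have "fo_definable (\<lambda>M s. s x \<in> elts (s u) \<and> s y \<in> elts (s u) \<and>
    (\<forall>z\<in>elts (s u). z = s x \<or> z = s y))"
    by (intro fo_definable_conj fo_definable_mem fo_definable_disj fo_definable_eq
        fo_definable_ball[where k = "Suc (u + x + y)"]) simp
  then show ?thesis
    by (rule fo_definable_cong) (auto simp: eq_set_of_pair)
qed

text \<open>In a Kuratowski pair both {x} and {x, y} are members of the pair, so every quantifier
  can be bounded.\<close>

lemma fo_definable_opair: "fo_definable (\<lambda>M s. s p = opair (s x) (s y))"
proof -
  have "fo_definable (\<lambda>M s. \<exists>u\<in>elts (s p). \<exists>v\<in>elts (s p).
    u = set_of {s x, s x} \<and> v = set_of {s x, s y} \<and> (\<forall>z\<in>elts (s p). z = u \<or> z = v))"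
    by (rule fo_definable_bex[where k = "Suc (p + x + y)"], simp,
      rule fo_definable_bex[where k = "Suc (Suc (p + x + y))"], simp,
      intro fo_definable_conj fo_definable_pair fo_definable_disj fo_definable_eq
        fo_definable_ball[where k = "Suc (Suc (Suc (p + x + y)))"]) simp
  then show ?thesis
    by (rule fo_definable_cong) (auto simp: opair_eq_iff_elts)
qed

lemma fo_definable_opair_mem: "fo_definable (\<lambda>M s. opair (s x) (s y) \<in> elts (s r))"
proof -
  have "fo_definable (\<lambda>M s. \<exists>p\<in>elts (s r). p = opair (s x) (s y))"
    by (rule fo_definable_bex[where k = "Suc (r + x + y)"], simp, rule fo_definable_opair)
  then show ?thesis by simp
qed

lemmas fo_definable_basic =
  fo_definable_conj fo_definable_disj fo_definable_imp fo_definable_iff fo_definable_not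
  fo_definable_opair_mem fo_definable_opair fo_definable_mem fo_definable_eq

text \<open>The position of a bound variable must be chosen by the rules: the freshness condition rejects
  positions in use, and proof search backtracks to the next one.\<close>

lemmas fo_definable_bounded =
  fo_definable_ball[where k = 10] fo_definable_bex[where k = 10]
  fo_definable_ball[where k = 11] fo_definable_bex[where k = 11]
  fo_definable_ball[where k = 12] fo_definable_bex[where k = 12]
  fo_definable_ball[where k = 13] fo_definable_bex[where k = 13]

section \<open>Elementary embeddings\<close>

locale embedding =
  fixes j :: "'v::zfc_universe \<Rightarrow> 'v" and M :: "'v set"
  assumes trans: "transitive_class M" and elem: "elementary_embedding j M"
begin

text \<open>The universe is itself a transitive class, so the formula for \<open>P\<close> has the
  intended meaning both there and in \<open>M\<close>; elementarity connects the two
  readings.\<close>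

lemma transfer:
  assumes "fo_definable P" shows "P UNIV s \<longleftrightarrow> P M (j \<circ> s)"
proof -
  from assms obtain \<phi> where \<phi>:
    "\<forall>M s. transitive_class M \<longrightarrow> range s \<subseteq> M \<longrightarrow> fo_sat M s \<phi> = P M s"
    unfolding fo_definable_def ..
  have "P UNIV s \<longleftrightarrow> fo_sat UNIV s \<phi>" using \<phi> by (simp add: transitive_class_def)
  also have "\<dots> \<longleftrightarrow> fo_sat M (j \<circ> s) \<phi>" using elem by (simp add: elementary_embedding_def)
  also have "\<dots> \<longleftrightarrow> P M (j \<circ> s)"
  proof -
    have "range (j \<circ> s) \<subseteq> M" using elem unfolding elementary_embedding_def by auto
    then show ?thesis using \<phi> trans by simp
  qed
  finally show ?thesis .
qed

lemma j_in_M: "j x \<in> M"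
  using elem unfolding elementary_embedding_def by auto

lemma elts_M: "x \<in> M \<Longrightarrow> y \<in> elts x \<Longrightarrow> y \<in> M"
  using trans unfolding transitive_class_def by auto

lemma j_mem [simp]: "j x \<in> elts (j y) \<longleftrightarrow> x \<in> elts y"
  \<comment> \<open>The assignment lists the parameters; positions past the end of the list hold
    unspecified values that the predicate never reads.\<close>
  using transfer[OF fo_definable_mem[of 0 1], of "(!) [x, y]"] by simp

lemma j_eq [simp]: "j x = j y \<longleftrightarrow> x = y"
  using transfer[OF fo_definable_eq[of 0 1], of "(!) [x, y]"] by simp

lemma j_opair [simp]: "j (opair x y) = opair (j x) (j y)"
  using transfer[OF fo_definable_opair[of 0 1 2], of "(!) [opair x y, x, y]"] by simp

text \<open>Later passes from membership of \<open>\<gamma>'\<close> in \<open>j \<delta>\<close> to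
  inclusion.\<close>

lemma j_Ord_trans:
  assumes "Ord \<alpha>" shows "\<forall>x\<in>elts (j \<alpha>). \<forall>y\<in>elts x. y \<in> elts (j \<alpha>)"
proof -
  have "fo_definable (\<lambda>M (s::nat \<Rightarrow> 'v). \<forall>x\<in>elts (s 0). \<forall>y\<in>elts x. y \<in> elts (s 0))"
    by ((rule fo_definable_basic | (rule fo_definable_bounded, (simp; fail)))+)
  from transfer[OF this, of "(!) [\<alpha>]"] show ?thesis
    using Ord_trans[OF assms] by simp
qed

end

section \<open>Coding functions and tuples\<close>

definition prod_set :: "'v::zfc_universe \<Rightarrow> 'v \<Rightarrow> 'v" where
  "prod_set a b = set_of (\<Union>x\<in>elts a. opair x ` elts b)"

lemma elts_prod_set: "elts (prod_set a b) = (\<Union>x\<in>elts a. opair x ` elts b)"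
  unfolding prod_set_def by (intro elts_set_of small_UN small_image small_elts)

lemma opair_mem_prod_set [simp]: "opair x y \<in> elts (prod_set a b) \<longleftrightarrow> x \<in> elts a \<and> y \<in> elts b"
  by (auto simp: elts_prod_set)

lemma elts_restricted_graph:
  "elts (restricted_graph \<alpha> f) = (\<lambda>x. opair x (f x)) ` elts \<alpha>"
  unfolding restricted_graph_def by (intro elts_set_of small_image small_elts)

lemma opair_mem_restricted_graph [simp]:
  "opair x y \<in> elts (restricted_graph \<alpha> f) \<longleftrightarrow> x \<in> elts \<alpha> \<and> y = f x"
  by (auto simp: elts_restricted_graph)

lemma restricted_graph_eq_iff:
  "restricted_graph \<alpha> f = restricted_graph \<alpha> g \<longleftrightarrow> (\<forall>x\<in>elts \<alpha>. f x = g x)"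
proof
  assume eq: "restricted_graph \<alpha> f = restricted_graph \<alpha> g"
  show "\<forall>x\<in>elts \<alpha>. f x = g x"
  proof
    fix x assume "x \<in> elts \<alpha>"
    then have "opair x (f x) \<in> elts (restricted_graph \<alpha> g)" unfolding eq[symmetric] by simp
    then show "f x = g x" by simp
  qed
next
  assume "\<forall>x\<in>elts \<alpha>. f x = g x"
  then have "elts (restricted_graph \<alpha> f) = elts (restricted_graph \<alpha> g)"
    unfolding elts_restricted_graph by (intro image_cong) simp_all
  then show "restricted_graph \<alpha> f = restricted_graph \<alpha> g" by (rule extensionality)
qed

definition fun_set :: "'v::zfc_universe \<Rightarrow> 'v \<Rightarrow> 'v" where
  "fun_set \<alpha> a = set_of {restricted_graph \<alpha> f | f. f ` elts \<alpha> \<subseteq> elts a}"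

lemma elts_fun_set: "elts (fun_set \<alpha> a) = {restricted_graph \<alpha> f | f. f ` elts \<alpha> \<subseteq> elts a}"
proof -
  have "{restricted_graph \<alpha> f | f. f ` elts \<alpha> \<subseteq> elts a} \<subseteq> {g. elts g \<subseteq> elts (prod_set \<alpha> a)}"
    by (auto simp: elts_restricted_graph image_subset_iff)
  with small_Pow[OF small_elts] have "small {restricted_graph \<alpha> f | f. f ` elts \<alpha> \<subseteq> elts a}"
    by (rule small_subset)
  then show ?thesis unfolding fun_set_def by (rule elts_set_of)
qed

lemma fun_set_memI: "f ` elts \<alpha> \<subseteq> elts a \<Longrightarrow> restricted_graph \<alpha> f \<in> elts (fun_set \<alpha> a)"
  by (auto simp: elts_fun_set)

text \<open>Describes functions by quantifiers bounded by \<open>g\<close>, \<alpha> and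
  \<open>a\<close>, so that the description can be read in a transitive class.\<close>

lemma fun_set_iff:
  "g \<in> elts (fun_set \<alpha> a) \<longleftrightarrow>
    (\<forall>p\<in>elts g. \<exists>x\<in>elts \<alpha>. \<exists>y\<in>elts a. p = opair x y) \<and>
    (\<forall>x\<in>elts \<alpha>. \<exists>y\<in>elts a. opair x y \<in> elts g) \<and>
    (\<forall>x\<in>elts \<alpha>. \<forall>y\<in>elts a. \<forall>z\<in>elts a. opair x y \<in> elts g \<and> opair x z \<in> elts g \<longrightarrow> y = z)"
    (is "_ \<longleftrightarrow> ?A \<and> ?B \<and> ?C")
proof
  assume "g \<in> elts (fun_set \<alpha> a)"
  then obtain f where "g = restricted_graph \<alpha> f" "f ` elts \<alpha> \<subseteq> elts a"
    unfolding elts_fun_set by blast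
  then show "?A \<and> ?B \<and> ?C" by (auto simp: elts_restricted_graph)
next
  assume *: "?A \<and> ?B \<and> ?C"
  then obtain f where f: "\<forall>x\<in>elts \<alpha>. f x \<in> elts a \<and> opair x (f x) \<in> elts g" by metis
  have "elts g = elts (restricted_graph \<alpha> f)"
    unfolding elts_restricted_graph
  proof
    show "elts g \<subseteq> (\<lambda>x. opair x (f x)) ` elts \<alpha>"
    proof
      fix p assume p: "p \<in> elts g"
      with * obtain x y where xy: "x \<in> elts \<alpha>" "y \<in> elts a" "p = opair x y" by meson
      with p * f have "y = f x" by metis
      with xy show "p \<in> (\<lambda>x. opair x (f x)) ` elts \<alpha>" by auto
    qed
  qed (use f in auto)
  then have "g = restricted_graph \<alpha> f" by (rule extensionality)
  then show "g \<in> elts (fun_set \<alpha> a)" using f fun_set_memI[of f \<alpha> a] by auto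
qed

text \<open>Built from pairs and the empty set only, both of which an embedding preserves; it
  therefore acts on a code by acting on the entries.\<close>

primrec code :: "'v::zfc_universe list \<Rightarrow> 'v" where
  "code [] = set_of {}"
| "code (x # xs) = opair x (code xs)"

lemma small_empty [simp, intro]: "small {}"
  using small_subset[OF small_singleton] by blast

text \<open>Keeps the code of the empty list apart from all other codes.\<close>

lemma opair_nonempty: "opair x y \<noteq> set_of {}"
proof
  assume "opair x y = set_of {}"
  then have "elts (opair x y) = {}" by (simp add: elts_set_of)
  moreover have "elts (opair x y) = {set_of {x}, set_of {x, y}}"
    using opair_eq_iff_elts by metis
  ultimately show False by simp
qed

lemma code_inject [simp]: "code xs = code ys \<longleftrightarrow> xs = ys"
proof (induction xs arbitrary: ys)
  case Nil
  then show ?case using opair_nonempty by (cases ys) (auto dest: sym)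
next
  case (Cons x xs)
  then show ?case using opair_nonempty by (cases ys) auto
qed

text \<open>The length is a natural number of HOL and not of the universe, so the image under
  \<open>j\<close> is computed by plain induction on it.\<close>

primrec tuples :: "nat \<Rightarrow> 'v::zfc_universe \<Rightarrow> 'v" where
  "tuples 0 a = set_of {set_of {}}"
| "tuples (Suc n) a = prod_set a (tuples n a)"

lemma elts_tuples: "elts (tuples n a) = code ` {xs \<in> lists (elts a). length xs = n}"
proof (induction n)
  case 0
  have "{xs \<in> lists (elts a). length xs = 0} = {[]}" by auto
  then show ?case by (simp add: elts_set_of)
next
  case (Suc n)
  have "{xs \<in> lists (elts a). length xs = Suc n} =
    (\<Union>x\<in>elts a. Cons x ` {xs \<in> lists (elts a). length xs = n})"
    by (auto simp: length_Suc_conv image_iff)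
  then show ?case by (auto simp: elts_prod_set Suc image_UN image_image)
qed

lemma code_mem_tuples [simp]:
  "code xs \<in> elts (tuples n a) \<longleftrightarrow> set xs \<subseteq> elts a \<and> length xs = n"
  by (auto simp: elts_tuples in_lists_conv_set)

section \<open>Images of products, tuples and codes under the embedding\<close>

context embedding
begin

lemma j_opair_mem: "opair x y \<in> elts z \<Longrightarrow> opair (j x) (j y) \<in> elts (j z)"
  unfolding j_opair[symmetric] j_mem .

lemma j_empty: "j (set_of {}) = set_of {}"
proof -
  have "fo_definable (\<lambda>M (s::nat \<Rightarrow> 'v). \<forall>x\<in>elts (s 0). \<not> x = x)"
    by ((rule fo_definable_basic | (rule fo_definable_bounded, (simp; fail)))+)
  from transfer[OF this, of "(!) [set_of {}]"] have "elts (j (set_of {})) = {}"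
    by (simp add: elts_set_of)
  then show ?thesis by (simp add: eq_set_of)
qed

lemma j_singleton: "elts (j (set_of {x})) = {j x}"
proof -
  have "fo_definable (\<lambda>M (s::nat \<Rightarrow> 'v). \<forall>x\<in>elts (s 0). x = s 1)"
    by ((rule fo_definable_basic | (rule fo_definable_bounded, (simp; fail)))+)
  from transfer[OF this, of "(!) [set_of {x}, x]"]
  have "\<forall>y\<in>elts (j (set_of {x})). y = j x" by (simp add: elts_set_of)
  moreover have "j x \<in> elts (j (set_of {x}))" by (simp add: elts_set_of)
  ultimately show ?thesis by auto
qed

lemma j_prod_set: "j (prod_set a b) = prod_set (j a) (j b)"
proof -
  have "fo_definable (\<lambda>M (s::nat \<Rightarrow> 'v).
    (\<forall>p\<in>elts (s 0). \<exists>x\<in>elts (s 1). \<exists>y\<in>elts (s 2). p = opair x y) \<and>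
    (\<forall>x\<in>elts (s 1). \<forall>y\<in>elts (s 2). opair x y \<in> elts (s 0)))"
    by ((rule fo_definable_basic | (rule fo_definable_bounded, (simp; fail)))+)
  from transfer[OF this, of "(!) [prod_set a b, a, b]"]
  have *: "(\<forall>p\<in>elts (j (prod_set a b)). \<exists>x\<in>elts (j a). \<exists>y\<in>elts (j b). p = opair x y) \<and>
    (\<forall>x\<in>elts (j a). \<forall>y\<in>elts (j b). opair x y \<in> elts (j (prod_set a b)))"
    by (simp add: elts_prod_set image_iff)
  have "elts (j (prod_set a b)) = elts (prod_set (j a) (j b))"
  proof
    show "elts (j (prod_set a b)) \<subseteq> elts (prod_set (j a) (j b))"
      using * by (fastforce simp: elts_prod_set)
  qed (use * in \<open>auto simp: elts_prod_set\<close>)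
  then show ?thesis by (rule extensionality)
qed

lemma j_tuples: "j (tuples n a) = tuples n (j a)"
proof (induction n)
  case 0
  have "elts (j (set_of {set_of {}})) = elts (set_of {set_of {}})"
    by (simp only: j_singleton j_empty elts_set_of[OF small_singleton])
  then show ?case unfolding elts_inject by simp
qed (simp add: j_prod_set)

lemma j_code: "j (code xs) = code (map j xs)"
  by (induction xs) (simp_all add: j_empty)

end

section \<open>Short families and function sets under the embedding\<close>

locale closed_embedding = embedding j M
  for j :: "'v::zfc_universe \<Rightarrow> 'v" and M +
  fixes \<kappa> \<eta> :: 'v
  assumes Ord_\<kappa>: "Ord \<kappa>" and \<kappa>_fixed: "\<And>\<alpha>. \<alpha> \<in> elts \<kappa> \<Longrightarrow> j \<alpha> = \<alpha>"
    and \<eta>_le_\<kappa>: "elts \<eta> \<subseteq> elts \<kappa>" and closed: "closed_under_seqs_below \<eta> M"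
begin

lemma \<kappa>_elts_fixed: "\<alpha> \<in> elts \<kappa> \<Longrightarrow> \<beta> \<in> elts \<alpha> \<Longrightarrow> j \<beta> = \<beta>"
  using Ord_trans[OF Ord_\<kappa>] \<kappa>_fixed by metis

text \<open>Let \<open>g\<close> be the graph of \<open>f\<close> on \<alpha>. Since
  \<open>j\<close> fixes \<alpha> and its members, \<open>j g\<close> is a relation on \<alpha> that
  still covers \<open>j x\<close> and relates \<open>b\<close> to \<open>j (f b)\<close>.
  Transferred single-valuedness leaves \<open>j x\<close> no other members than these.\<close>

lemma elts_j_small:
  assumes \<alpha>: "\<alpha> \<in> elts \<kappa>" and x: "elts x \<subseteq> f ` elts \<alpha>"
  shows "elts (j x) = j ` elts x"
proof
  define g where "g = restricted_graph \<alpha> f"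
  \<comment> \<open>The full range of \<open>f\<close>, which may exceed \<open>x\<close>; it bounds
    the second value in the single-valuedness clause.\<close>
  define c where "c = set_of (f ` elts \<alpha>)"
  have c: "elts c = f ` elts \<alpha>" unfolding c_def by (intro elts_set_of small_image small_elts)
  have "fo_definable (\<lambda>M (s::nat \<Rightarrow> 'v).
    (\<forall>y\<in>elts (s 0). \<exists>b\<in>elts (s 1). opair b y \<in> elts (s 2)) \<and>
    (\<forall>b\<in>elts (s 1). \<forall>y\<in>elts (s 0). \<forall>z\<in>elts (s 3).
      opair b y \<in> elts (s 2) \<and> opair b z \<in> elts (s 2) \<longrightarrow> y = z))"
    by ((rule fo_definable_basic | (rule fo_definable_bounded, (simp; fail)))+)
  moreover have "\<forall>y\<in>elts x. \<exists>b\<in>elts \<alpha>. y = f b" using x by auto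
  ultimately have *: "\<forall>y\<in>elts (j x). \<exists>b\<in>elts \<alpha>. opair b y \<in> elts (j g)"
    "\<forall>b\<in>elts \<alpha>. \<forall>y\<in>elts (j x). \<forall>z\<in>elts (j c).
      opair b y \<in> elts (j g) \<and> opair b z \<in> elts (j g) \<longrightarrow> y = z"
    using transfer[of "\<lambda>M s.
    (\<forall>y\<in>elts (s 0). \<exists>b\<in>elts (s 1). opair b y \<in> elts (s 2)) \<and>
    (\<forall>b\<in>elts (s 1). \<forall>y\<in>elts (s 0). \<forall>z\<in>elts (s 3).
      opair b y \<in> elts (s 2) \<and> opair b z \<in> elts (s 2) \<longrightarrow> y = z)" "(!) [x, \<alpha>, g, c]"]
    by (simp_all add: g_def \<kappa>_fixed[OF \<alpha>])
  show "elts (j x) \<subseteq> j ` elts x"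
  proof
    fix y assume y: "y \<in> elts (j x)"
    with *(1) obtain b where b: "b \<in> elts \<alpha>" "opair b y \<in> elts (j g)" by auto
    have "opair b (f b) \<in> elts g" unfolding g_def using b by simp
    then have "opair (j b) (j (f b)) \<in> elts (j g)" by (rule j_opair_mem)
    then have "opair b (j (f b)) \<in> elts (j g)" unfolding \<kappa>_elts_fixed[OF \<alpha> b(1)] .
    moreover have "j (f b) \<in> elts (j c)" using b c by simp
    ultimately have "y = j (f b)" using *(2) b y by auto
    \<comment> \<open>As \<open>j (f b)\<close> lies in \<open>j x\<close>, \<open>j_mem\<close>
      returns \<open>f b\<close> to \<open>x\<close>.\<close>
    then show "y \<in> j ` elts x" using y by auto
  qed
qed auto

text \<open>The case of \<open>elts_j_small\<close> where the family is the identity. It applies to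
  blocks of quantified variables, which are coded as sets of indices below an ordinal less than
  \<kappa>.\<close>

lemma j_subset_fixed:
  assumes "\<alpha> \<in> elts \<kappa>" "elts x \<subseteq> elts \<alpha>" shows "j x = x"
proof -
  have "elts (j x) = j ` elts x" using elts_j_small[of \<alpha> x "\<lambda>y. y"] assms by simp
  also have "\<dots> = elts x" using \<kappa>_elts_fixed[OF assms(1)] assms(2) by force
  finally show ?thesis by (rule extensionality)
qed

lemma j_restricted_graph:
  assumes "\<alpha> \<in> elts \<kappa>"
  shows "j (restricted_graph \<alpha> f) = restricted_graph \<alpha> (\<lambda>x. j (f x))"
proof -
  have "elts (j (restricted_graph \<alpha> f)) = j ` elts (restricted_graph \<alpha> f)"
    using elts_j_small[OF assms, of "restricted_graph \<alpha> f"] unfolding elts_restricted_graph by blast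
  also have "\<dots> = elts (restricted_graph \<alpha> (\<lambda>x. j (f x)))"
    unfolding elts_restricted_graph image_image
    using \<kappa>_elts_fixed[OF assms] by (intro image_cong) simp_all
  finally show ?thesis by (rule extensionality)
qed

text \<open>Elementarity shows that \<open>j (fun_set \<alpha> a)\<close> consists of those
  functions from \<alpha> to \<open>j a\<close> that lie in \<open>M\<close>. Closure of
  \<open>M\<close> under sequences of length below \<eta> puts every such function into
  \<open>M\<close>.\<close>

lemma j_fun_set:
  assumes \<alpha>: "\<alpha> \<in> elts \<eta>" shows "j (fun_set \<alpha> a) = fun_set \<alpha> (j a)"
proof -
  have \<alpha>\<kappa>: "\<alpha> \<in> elts \<kappa>" using \<alpha> \<eta>_le_\<kappa> by auto
  \<comment> \<open>That every function belongs to the set is not a bounded statement, so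
    \<open>g\<close> ranges over the whole class.\<close>
  have "fo_definable (\<lambda>M (s::nat \<Rightarrow> 'v). \<forall>g\<in>M. g \<in> elts (s 0) \<longleftrightarrow>
    (\<forall>p\<in>elts g. \<exists>x\<in>elts (s 1). \<exists>y\<in>elts (s 2). p = opair x y) \<and>
    (\<forall>x\<in>elts (s 1). \<exists>y\<in>elts (s 2). opair x y \<in> elts g) \<and>
    (\<forall>x\<in>elts (s 1). \<forall>y\<in>elts (s 2). \<forall>z\<in>elts (s 2).
      opair x y \<in> elts g \<and> opair x z \<in> elts g \<longrightarrow> y = z))"
    by (rule fo_definable_all[where k = 3], simp)
      ((rule fo_definable_basic | (rule fo_definable_bounded, (simp; fail)))+)
  from transfer[OF this, of "(!) [fun_set \<alpha> a, \<alpha>, a]"]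
  have *: "\<forall>g\<in>M. g \<in> elts (j (fun_set \<alpha> a)) \<longleftrightarrow> g \<in> elts (fun_set \<alpha> (j a))"
    by (simp add: \<kappa>_fixed[OF \<alpha>\<kappa>] fun_set_iff)
  moreover have "g \<in> M" if "g \<in> elts (j (fun_set \<alpha> a))" for g
    using that elts_M j_in_M by blast
  moreover have "g \<in> M" if "g \<in> elts (fun_set \<alpha> (j a))" for g
  proof -
    from that obtain f where f: "g = restricted_graph \<alpha> f" "f ` elts \<alpha> \<subseteq> elts (j a)"
      unfolding elts_fun_set by auto
    then have "f ` elts \<alpha> \<subseteq> M" using elts_M[OF j_in_M] by auto
    then show ?thesis using closed \<alpha> unfolding closed_under_seqs_below_def f(1) by auto
  qed
  ultimately have "elts (j (fun_set \<alpha> a)) = elts (fun_set \<alpha> (j a))" by blast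
  then show ?thesis by (rule extensionality)
qed

end

section \<open>Variables of formulas\<close>

primrec tvars :: "'v trm \<Rightarrow> 'v set" where
  "tvars (Var v) = {v}"
| "tvars (App f ts) = \<Union> (set (map tvars ts))"

text \<open>Bound variables are included, because coded assignments must also record the values that
  quantifiers give to them.\<close>

primrec allvars :: "'v form \<Rightarrow> 'v set" where
  "allvars (EqF t u) = tvars t \<union> tvars u"
| "allvars (RelF r ts) = \<Union> (tvars ` set ts)"
| "allvars (NegF \<phi>) = allvars \<phi>"
| "allvars (ConjF I \<Phi>) = (\<Union>i\<in>I. allvars (\<Phi> i))"
| "allvars (DisjF I \<Phi>) = (\<Union>i\<in>I. allvars (\<Phi> i))"
| "allvars (ExF X \<phi>) = X \<union> allvars \<phi>"
| "allvars (AllF X \<phi>) = X \<union> allvars \<phi>"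

lemma finite_tvars: "finite (tvars t)"
  by (induction t) auto

text \<open>Atomic formulas contain finitely many variables, and regularity of \<eta> keeps unions
  of fewer than \<eta> small sets small.\<close>

lemma allvars_lesspoll:
  assumes "regular_card \<eta>" shows "L_form \<eta> \<tau> \<phi> \<Longrightarrow> allvars \<phi> \<prec> elts \<eta>"
proof (induction \<phi>)
  case (EqF t u)
  show ?case by (rule finite_lesspoll_regular[OF assms]) (simp add: finite_tvars)
next
  case (RelF r ts)
  show ?case by (rule finite_lesspoll_regular[OF assms]) (simp add: finite_tvars)
next
  case (ConjF I \<Phi>)
  then show ?case by (simp add: regular_card_UN_lesspoll[OF assms])
next
  case (DisjF I \<Phi>)
  then show ?case by (simp add: regular_card_UN_lesspoll[OF assms])
qed (simp_all add: regular_card_Un_lesspoll[OF assms])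

lemma term_val_cong: "\<forall>v\<in>tvars u. s v = t v \<Longrightarrow> term_val A s u = term_val A t u"
proof (induction u)
  case (App f ts)
  then have "map (term_val A s) ts = map (term_val A t) ts" by (intro map_cong) auto
  then show ?case by (simp del: map_eq_conv)
qed simp

lemma term_val_mem:
  assumes "is_structure \<tau> A" "range s \<subseteq> elts (domain A)"
  shows "is_term \<tau> u \<Longrightarrow> term_val A s u \<in> elts (domain A)"
proof (induction u)
  case (Var v)
  then show ?case using assms(2) by auto
next
  case (App f ts)
  then have "map (term_val A s) ts \<in> lists (elts (domain A))"
    by (auto simp: in_lists_conv_set list_all_iff)
  with App.prems assms(1) show ?case unfolding is_structure_def by simp
qed

lemma L_sat_cong: "\<forall>v\<in>allvars \<phi>. s v = t v \<Longrightarrow> L_sat A s \<phi> = L_sat A t \<phi>"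
proof (induction \<phi> arbitrary: s t)
  case (EqF u w)
  then have "term_val A s u = term_val A t u" "term_val A s w = term_val A t w"
    by (simp_all add: term_val_cong)
  then show ?case by simp
next
  case (RelF r ts)
  then have "map (term_val A s) ts = map (term_val A t) ts"
    by (intro map_cong refl term_val_cong) auto
  then show ?case by (simp del: map_eq_conv)
next
  case (NegF \<phi>)
  then have "L_sat A s \<phi> = L_sat A t \<phi>" by simp
  then show ?case by simp
next
  case (ConjF I \<Phi>)
  have "L_sat A s (\<Phi> i) = L_sat A t (\<Phi> i)" if "i \<in> I" for i
    using ConjF that by auto
  then show ?case by simp
next
  case (DisjF I \<Phi>)
  have "L_sat A s (\<Phi> i) = L_sat A t (\<Phi> i)" if "i \<in> I" for i
    using DisjF that by auto
  then show ?case by simp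
next
  case (ExF X \<phi>)
  have "L_sat A (override_on s u X) \<phi> = L_sat A (override_on t u X) \<phi>" for u
    by (rule ExF.IH) (use ExF.prems in \<open>auto simp: override_on_def\<close>)
  then show ?case by simp
next
  case (AllF X \<phi>)
  have "L_sat A (override_on s u X) \<phi> = L_sat A (override_on t u X) \<phi>" for u
    by (rule AllF.IH) (use AllF.prems in \<open>auto simp: override_on_def\<close>)
  then show ?case by simp
qed

text \<open>Quantification over variants of \<open>t\<close> on \<open>X\<close> becomes quantification over elements of a set. The
  lemma is used in the ground model with \<open>i\<close> the identity, and in the target model.\<close>

lemma ex_override_iff:
  assumes i: "bij_betw i D (elts d)" and e: "inj_on e (elts \<alpha>)" and t: "range t \<subseteq> D"
    and X: "X \<subseteq> e ` elts \<alpha>" and x: "elts x = {\<beta> \<in> elts \<alpha>. e \<beta> \<in> X}"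
  shows "(\<exists>u. u ` X \<subseteq> D \<and> P (restricted_graph \<alpha> (\<lambda>\<beta>. i (override_on t u X (e \<beta>))))) \<longleftrightarrow>
    (\<exists>g\<in>elts (fun_set \<alpha> d). P g \<and> (\<forall>\<beta>\<in>elts \<alpha>. \<not> \<beta> \<in> elts x \<longrightarrow> (\<forall>y\<in>elts d.
      opair \<beta> y \<in> elts g \<longleftrightarrow> opair \<beta> y \<in> elts (restricted_graph \<alpha> (\<lambda>\<beta>. i (t (e \<beta>)))))))"
    (is "?L \<longleftrightarrow> ?R")
proof
  assume ?L
  then obtain u where u: "u ` X \<subseteq> D" "P (restricted_graph \<alpha> (\<lambda>\<beta>. i (override_on t u X (e \<beta>))))"
    by blast
  have "i (override_on t u X v) \<in> elts d" for v
  proof -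
    have "override_on t u X v \<in> D" using u(1) t by (cases "v \<in> X") auto
    then show ?thesis using bij_betwE[OF i] by auto
  qed
  then have mem: "restricted_graph \<alpha> (\<lambda>\<beta>. i (override_on t u X (e \<beta>))) \<in> elts (fun_set \<alpha> d)"
    by (intro fun_set_memI) auto
  show ?R by (rule bexI[OF _ mem], rule conjI, rule u(2)) (auto simp: x override_on_def)
next
  assume ?R
  then obtain g where g: "g \<in> elts (fun_set \<alpha> d)" "P g"
    "\<forall>\<beta>\<in>elts \<alpha>. \<not> \<beta> \<in> elts x \<longrightarrow> (\<forall>y\<in>elts d.
      opair \<beta> y \<in> elts g \<longleftrightarrow> opair \<beta> y \<in> elts (restricted_graph \<alpha> (\<lambda>\<beta>. i (t (e \<beta>)))))"
    by blast
  from g(1) obtain f where f: "g = restricted_graph \<alpha> f" "f ` elts \<alpha> \<subseteq> elts d"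
    unfolding elts_fun_set by auto
  \<comment> \<open>The witness reads \<open>f\<close> at the index of the variable and pulls the
    value back along \<open>i\<close> to \<open>D\<close>.\<close>
  define u where "u v = inv_into D i (f (inv_into (elts \<alpha>) e v))" for v
  have surj: "i ` D = elts d" using i by (rule bij_betw_imp_surj_on)
  have u_e: "u (e \<beta>) \<in> D \<and> i (u (e \<beta>)) = f \<beta>" if "\<beta> \<in> elts \<alpha>" for \<beta>
  proof -
    have "f \<beta> \<in> i ` D" using f(2) that surj by auto
    then show ?thesis using that
      by (simp add: u_def inv_into_f_f[OF e] inv_into_into f_inv_into_f)
  qed
  then have "u ` X \<subseteq> D" using X by auto
  moreover have "i (override_on t u X (e \<beta>)) = f \<beta>" if \<beta>: "\<beta> \<in> elts \<alpha>" for \<beta>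
  proof (cases "e \<beta> \<in> X")
    case True
    then show ?thesis using u_e[OF \<beta>] by simp
  next
    case False
    have "f \<beta> \<in> elts d" using f(2) \<beta> by auto
    \<comment> \<open>Outside the block the two graphs contain the same pairs; using this for the
      value \<open>f \<beta>\<close> identifies the functions at \<beta>.\<close>
    then have "opair \<beta> (f \<beta>) \<in> elts (restricted_graph \<alpha> (\<lambda>\<beta>. i (t (e \<beta>))))"
      using g(3) \<beta> False unfolding f(1) x by auto
    then show ?thesis using False by simp
  qed
  then have "restricted_graph \<alpha> (\<lambda>\<beta>. i (override_on t u X (e \<beta>))) = g"
    unfolding f(1) restricted_graph_eq_iff by blast
  ultimately show ?L using g(2) by auto
qed

section \<open>Coding satisfaction\<close>

text \<open>The injection \<open>e\<close> names variables by members of \<alpha>, so an assignment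
  becomes a function on \<alpha>, a set to which \<open>j\<close> can be applied.\<close>

locale coded_structure =
  fixes \<tau> :: "'v::zfc_universe language" and A :: "'v struct" and \<alpha> :: 'v and e :: "'v \<Rightarrow> 'v"
  assumes struct_A: "is_structure \<tau> A" and inj_e: "inj_on e (elts \<alpha>)"
begin

abbreviation asg :: "('v \<Rightarrow> 'v) \<Rightarrow> 'v" where
  "asg s \<equiv> restricted_graph \<alpha> (\<lambda>\<beta>. s (e \<beta>))"

text \<open>The graph of evaluation as a set of the universe. It is single-valued once
  \<open>e\<close> enumerates all variables of \<open>us\<close>.\<close>

definition tvals :: "'v trm list \<Rightarrow> 'v" where
  "tvals us = set_of {opair (asg s) (code (map (term_val A s) us)) | s. range s \<subseteq> elts (domain A)}"

definition tval :: "'v trm \<Rightarrow> 'v" where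
  "tval u = set_of {opair (asg s) (term_val A s u) | s. range s \<subseteq> elts (domain A)}"

definition sat :: "'v form \<Rightarrow> 'v" where
  "sat \<phi> = set_of {asg s | s. range s \<subseteq> elts (domain A) \<and> L_sat A s \<phi>}"

abbreviation asgs :: 'v where
  "asgs \<equiv> fun_set \<alpha> (domain A)"

lemma asg_mem: "range s \<subseteq> elts (domain A) \<Longrightarrow> asg s \<in> elts asgs"
  by (intro fun_set_memI) auto

lemma asg_cases:
  assumes "g \<in> elts asgs"
  obtains s where "g = asg s" "range s \<subseteq> elts (domain A)"
proof -
  from assms obtain f where f: "g = restricted_graph \<alpha> f" "f ` elts \<alpha> \<subseteq> elts (domain A)"
    unfolding elts_fun_set by auto
  \<comment> \<open>A default value for the variables that \<open>e\<close> does not enumerate;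
    domains are nonempty.\<close>
  obtain a where a: "a \<in> elts (domain A)" using struct_A unfolding is_structure_def by auto
  define s where "s v = (if v \<in> e ` elts \<alpha> then f (inv_into (elts \<alpha>) e v) else a)" for v
  have "g = asg s" unfolding f(1) restricted_graph_eq_iff s_def by (simp add: inj_e)
  moreover have "range s \<subseteq> elts (domain A)" using f(2) a by (auto simp: s_def inj_e)
  ultimately show ?thesis by (rule that)
qed

lemma asg_eqD: "asg s = asg t \<Longrightarrow> W \<subseteq> e ` elts \<alpha> \<Longrightarrow> \<forall>v\<in>W. s v = t v"
  unfolding restricted_graph_eq_iff by auto

lemma elts_tval:
  assumes "is_term \<tau> u"
  shows "elts (tval u) = {opair (asg s) (term_val A s u) | s. range s \<subseteq> elts (domain A)}"
  unfolding tval_def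
proof (rule elts_set_of, rule small_subset[OF small_elts])
  show "{opair (asg s) (term_val A s u) | s. range s \<subseteq> elts (domain A)} \<subseteq>
      elts (prod_set asgs (domain A))"
    using asg_mem term_val_mem[OF struct_A _ assms] by auto
qed

lemma elts_tvals:
  assumes "list_all (is_term \<tau>) us"
  shows "elts (tvals us) =
    {opair (asg s) (code (map (term_val A s) us)) | s. range s \<subseteq> elts (domain A)}"
  unfolding tvals_def
proof (rule elts_set_of, rule small_subset[OF small_elts])
  show "{opair (asg s) (code (map (term_val A s) us)) | s. range s \<subseteq> elts (domain A)} \<subseteq>
      elts (prod_set asgs (tuples (length us) (domain A)))"
    using asg_mem term_val_mem[OF struct_A] assms by (auto simp: list_all_iff)
qed

lemma elts_sat: "elts (sat \<phi>) = {asg s | s. range s \<subseteq> elts (domain A) \<and> L_sat A s \<phi>}"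
  unfolding sat_def
proof (rule elts_set_of, rule small_subset[OF small_elts])
  show "{asg s | s. range s \<subseteq> elts (domain A) \<and> L_sat A s \<phi>} \<subseteq> elts asgs"
    using asg_mem by auto
qed

text \<open>The code of an assignment determines it on the enumerated variables, and satisfaction
  depends only on the variables of \<phi>.\<close>

lemma asg_mem_sat:
  assumes "range s \<subseteq> elts (domain A)" "allvars \<phi> \<subseteq> e ` elts \<alpha>"
  shows "asg s \<in> elts (sat \<phi>) \<longleftrightarrow> L_sat A s \<phi>"
proof
  assume "asg s \<in> elts (sat \<phi>)"
  then obtain t where t: "asg s = asg t" "L_sat A t \<phi>" unfolding elts_sat by auto
  show "L_sat A s \<phi>" using L_sat_cong[OF asg_eqD[OF t(1) assms(2)]] t(2) by simp
qed (use assms in \<open>auto simp: elts_sat\<close>)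

lemma tval_opair_iff:
  assumes "range s \<subseteq> elts (domain A)" "is_term \<tau> u" "tvars u \<subseteq> e ` elts \<alpha>"
  shows "opair (asg s) y \<in> elts (tval u) \<longleftrightarrow> y = term_val A s u"
proof
  assume "opair (asg s) y \<in> elts (tval u)"
  then obtain t where t: "asg s = asg t" "y = term_val A t u" unfolding elts_tval[OF assms(2)] by auto
  show "y = term_val A s u" using term_val_cong[OF asg_eqD[OF t(1) assms(3)]] t(2) by simp
qed (use assms in \<open>auto simp: elts_tval\<close>)

lemma tvals_opair_iff:
  assumes "range s \<subseteq> elts (domain A)" "list_all (is_term \<tau>) us" "\<Union> (tvars ` set us) \<subseteq> e ` elts \<alpha>"
  shows "opair (asg s) c \<in> elts (tvals us) \<longleftrightarrow> c = code (map (term_val A s) us)"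
proof
  assume "opair (asg s) c \<in> elts (tvals us)"
  then obtain t where t: "asg s = asg t" "c = code (map (term_val A t) us)"
    unfolding elts_tvals[OF assms(2)] by auto
  have "map (term_val A s) us = map (term_val A t) us"
    using asg_eqD[OF t(1) assms(3)] by (intro map_cong refl term_val_cong) auto
  then show "c = code (map (term_val A s) us)" using t(2) by (simp del: map_eq_conv)
next
  assume "c = code (map (term_val A s) us)"
  then show "opair (asg s) c \<in> elts (tvals us)" using assms(1) unfolding elts_tvals[OF assms(2)] by blast
qed

end

section \<open>The extension\<close>

text \<open>Interpretations are HOL functions, to which \<open>j\<close> does not apply. Their
  restrictions to tuples of the correct length are coded as sets.\<close>

definition rel_code :: "'v::zfc_universe language \<Rightarrow> 'v struct \<Rightarrow> 'v \<Rightarrow> 'v" where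
  "rel_code \<tau> A r = set_of (code ` {xs \<in> lists (elts (domain A)). length xs = rel_arity \<tau> r \<and> rel_int A r xs})"

definition fun_code :: "'v::zfc_universe language \<Rightarrow> 'v struct \<Rightarrow> 'v \<Rightarrow> 'v" where
  "fun_code \<tau> A f = set_of ((\<lambda>xs. opair (code xs) (fun_int A f xs)) `
     {xs \<in> lists (elts (domain A)). length xs = fun_arity \<tau> f})"

lemma elts_rel_code: "elts (rel_code \<tau> A r) =
    code ` {xs \<in> lists (elts (domain A)). length xs = rel_arity \<tau> r \<and> rel_int A r xs}"
  unfolding rel_code_def
  by (rule elts_set_of, rule small_subset[OF small_elts[of "tuples (rel_arity \<tau> r) (domain A)"]])
    (auto simp: in_lists_conv_set)

lemma elts_fun_code: "elts (fun_code \<tau> A f) = (\<lambda>xs. opair (code xs) (fun_int A f xs)) `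
    {xs \<in> lists (elts (domain A)). length xs = fun_arity \<tau> f}"
proof -
  \<comment> \<open>Replacement speaks of images of sets of the universe, so the lists are recovered
    from their codes by inverting \<open>code\<close>.\<close>
  have "(\<lambda>xs. opair (code xs) (fun_int A f xs)) `
    {xs \<in> lists (elts (domain A)). length xs = fun_arity \<tau> f} =
    (\<lambda>c. opair c (fun_int A f (the_inv code c))) ` elts (tuples (fun_arity \<tau> f) (domain A))"
    unfolding elts_tuples image_image by (simp add: the_inv_f_f inj_def)
  then show ?thesis unfolding fun_code_def
    by (intro elts_set_of) (simp add: small_image)
qed

text \<open>\<open>D\<close> is the domain of the copy of \<open>j A\<close>, and \<open>i\<close>
  is the isomorphism from the copy. As \<open>i\<close> agrees with \<open>j\<close> on
  \<open>A\<close>, the inclusion of \<open>A\<close> in \<open>D\<close> corresponds to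
  \<open>j\<close>.\<close>

locale structure_embedding = closed_embedding j M \<kappa> \<eta>
  for j :: "'v::zfc_universe \<Rightarrow> 'v" and M \<kappa> \<eta> +
  fixes \<tau> :: "'v language" and A :: "'v struct" and D :: 'v and i :: "'v \<Rightarrow> 'v"
  assumes A_structure: "is_structure \<tau> A" and regular: "regular_card \<eta>"
    and bij_i: "bij_betw i (elts D) (elts (j (domain A)))"
    and A_sub_D: "elts (domain A) \<subseteq> elts D"
    and i_eq_j: "\<And>x. x \<in> elts (domain A) \<Longrightarrow> i x = j x"
begin

text \<open>The structure \<open>j A\<close> pulled back along \<open>i\<close>. A symbol is read as
  \<open>j\<close> of its interpretation in \<open>A\<close>, so the language stays the same even if
  \<open>j\<close> moves symbols. For function symbols and tuples from \<open>D\<close> of the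
  correct length the choice is unambiguous by \<open>j_fun_code\<close>.\<close>

definition ext :: "'v struct" where
  "ext = \<lparr>domain = D,
    rel_int = \<lambda>r xs. code (map i xs) \<in> elts (j (rel_code \<tau> A r)),
    fun_int = \<lambda>f xs. inv_into (elts D) i (SOME y. y \<in> elts (j (domain A)) \<and>
      opair (code (map i xs)) y \<in> elts (j (fun_code \<tau> A f)))\<rparr>"

lemma domain_ext [simp]: "domain ext = D"
  by (simp add: ext_def)

lemma i_mem: "x \<in> elts D \<Longrightarrow> i x \<in> elts (j (domain A))"
  using bij_betwE[OF bij_i] by blast

text \<open>Totality and single-valuedness on tuples of the correct length are bounded statements,
  true of \<open>fun_code \<tau> A f\<close> and hence transferred; \<open>j_tuples\<close> computes
  the set of tuples in the target.\<close>

lemma j_fun_code: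
  assumes f: "f \<in> elts (fun_syms \<tau>)" and xs: "set xs \<subseteq> elts (j (domain A))" "length xs = fun_arity \<tau> f"
  shows "\<exists>!y. y \<in> elts (j (domain A)) \<and> opair (code xs) y \<in> elts (j (fun_code \<tau> A f))"
proof -
  let ?C = "tuples (fun_arity \<tau> f) (domain A)"
  have "fo_definable (\<lambda>M (s::nat \<Rightarrow> 'v). \<forall>c\<in>elts (s 0). (\<exists>y\<in>elts (s 1). opair c y \<in> elts (s 2)) \<and>
      (\<forall>y\<in>elts (s 1). \<forall>z\<in>elts (s 1). opair c y \<in> elts (s 2) \<and> opair c z \<in> elts (s 2) \<longrightarrow> y = z))"
    by ((rule fo_definable_basic | (rule fo_definable_bounded, (simp; fail)))+)
  note tr = transfer[OF this, of "(!) [?C, domain A, fun_code \<tau> A f]"]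
  have "\<forall>c\<in>elts ?C. (\<exists>y\<in>elts (domain A). opair c y \<in> elts (fun_code \<tau> A f)) \<and>
      (\<forall>y\<in>elts (domain A). \<forall>z\<in>elts (domain A).
        opair c y \<in> elts (fun_code \<tau> A f) \<and> opair c z \<in> elts (fun_code \<tau> A f) \<longrightarrow> y = z)"
  proof
    fix c assume "c \<in> elts ?C"
    then obtain xs where xs: "c = code xs" "xs \<in> lists (elts (domain A))" "length xs = fun_arity \<tau> f"
      unfolding elts_tuples by blast
    have "opair c y \<in> elts (fun_code \<tau> A f) \<longleftrightarrow> y = fun_int A f xs" for y
      unfolding elts_fun_code xs(1) using xs(2,3) by auto
    moreover have "fun_int A f xs \<in> elts (domain A)"
      using A_structure f xs unfolding is_structure_def by auto
    ultimately show "(\<exists>y\<in>elts (domain A). opair c y \<in> elts (fun_code \<tau> A f)) \<and>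
      (\<forall>y\<in>elts (domain A). \<forall>z\<in>elts (domain A).
        opair c y \<in> elts (fun_code \<tau> A f) \<and> opair c z \<in> elts (fun_code \<tau> A f) \<longrightarrow> y = z)"
      by simp
  qed
  with tr have "\<forall>c\<in>elts (tuples (fun_arity \<tau> f) (j (domain A))).
      (\<exists>y\<in>elts (j (domain A)). opair c y \<in> elts (j (fun_code \<tau> A f))) \<and>
      (\<forall>y\<in>elts (j (domain A)). \<forall>z\<in>elts (j (domain A)).
        opair c y \<in> elts (j (fun_code \<tau> A f)) \<and> opair c z \<in> elts (j (fun_code \<tau> A f)) \<longrightarrow> y = z)"
    by (simp add: j_tuples)
  moreover have "code xs \<in> elts (tuples (fun_arity \<tau> f) (j (domain A)))" using xs by simp
  ultimately show ?thesis by blast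
qed

lemma fun_int_ext:
  assumes f: "f \<in> elts (fun_syms \<tau>)" and xs: "set xs \<subseteq> elts D" "length xs = fun_arity \<tau> f"
  shows "fun_int ext f xs \<in> elts D"
    and "opair (code (map i xs)) (i (fun_int ext f xs)) \<in> elts (j (fun_code \<tau> A f))"
proof -
  have "set (map i xs) \<subseteq> elts (j (domain A))" using xs(1) i_mem by auto
  from j_fun_code[OF f this] xs(2)
  have "\<exists>y. y \<in> elts (j (domain A)) \<and> opair (code (map i xs)) y \<in> elts (j (fun_code \<tau> A f))"
    by auto
  note some = someI_ex[OF this]
  define y where "y = (SOME y. y \<in> elts (j (domain A)) \<and>
    opair (code (map i xs)) y \<in> elts (j (fun_code \<tau> A f)))"
  have y: "y \<in> elts (j (domain A))" "opair (code (map i xs)) y \<in> elts (j (fun_code \<tau> A f))"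
    "fun_int ext f xs = inv_into (elts D) i y"
    using some by (simp_all add: ext_def y_def)
  have "y \<in> i ` elts D" using y(1) bij_betw_imp_surj_on[OF bij_i] by simp
  then show "fun_int ext f xs \<in> elts D"
    and "opair (code (map i xs)) (i (fun_int ext f xs)) \<in> elts (j (fun_code \<tau> A f))"
    using y by (simp_all add: inv_into_into f_inv_into_f)
qed

lemma is_structure_ext: "is_structure \<tau> ext"
  using A_structure A_sub_D fun_int_ext(1) unfolding is_structure_def
  by (auto simp: in_lists_conv_set subset_iff)

lemma map_i_eq: "set xs \<subseteq> elts (domain A) \<Longrightarrow> map i xs = map j xs"
  using i_eq_j by auto

text \<open>On \<open>A\<close> the map \<open>i\<close> is \<open>j\<close>, which commutes with
  codes and pairs, so elementarity compares the interpretations at tuples from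
  \<open>A\<close>.\<close>

lemma substructure_ext: "substructure \<tau> A ext"
  unfolding substructure_def
proof (intro conjI ballI impI)
  show "elts (domain A) \<subseteq> elts (domain ext)" using A_sub_D by simp
next
  fix r xs assume *: "xs \<in> lists (elts (domain A))" "length xs = rel_arity \<tau> r"
  then have "set xs \<subseteq> elts (domain A)" by auto
  then have "rel_int ext r xs \<longleftrightarrow> j (code xs) \<in> elts (j (rel_code \<tau> A r))"
    by (simp only: j_code map_i_eq ext_def struct.simps)
  also have "\<dots> \<longleftrightarrow> rel_int A r xs" using * by (auto simp: elts_rel_code)
  finally show "rel_int A r xs \<longleftrightarrow> rel_int ext r xs" by simp
next
  fix f xs assume f: "f \<in> elts (fun_syms \<tau>)"
    and *: "xs \<in> lists (elts (domain A))" "length xs = fun_arity \<tau> f"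
  then have xs: "set xs \<subseteq> elts (domain A)" by auto
  have mem: "fun_int A f xs \<in> elts (domain A)" using A_structure f * unfolding is_structure_def by auto
  have "opair (code xs) (fun_int A f xs) \<in> elts (fun_code \<tau> A f)" using * by (auto simp: elts_fun_code)
  from j_opair_mem[OF this]
  have 1: "opair (code (map i xs)) (i (fun_int A f xs)) \<in> elts (j (fun_code \<tau> A f))"
    by (simp only: j_code map_i_eq[OF xs] i_eq_j[OF mem])
  have xsD: "set xs \<subseteq> elts D" using xs A_sub_D by auto
  have "set (map i xs) \<subseteq> elts (j (domain A))" using xsD i_mem by auto
  \<comment> \<open>Both values are related to the same tuple, so uniqueness identifies their images
    under \<open>i\<close>.\<close>
  from j_fun_code[OF f this] *(2) 1 fun_int_ext[OF f xsD *(2)] mem A_sub_D i_mem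
  have "i (fun_int A f xs) = i (fun_int ext f xs)" by (metis length_map subsetD)
  then show "fun_int A f xs = fun_int ext f xs"
    using bij_betw_imp_inj_on[OF bij_i] mem A_sub_D fun_int_ext(1)[OF f xsD *(2)]
    by (auto dest: inj_onD)
qed

end

section \<open>Evaluation of terms under the embedding\<close>

locale coded_embedding = structure_embedding j M \<kappa> \<eta> \<tau> A D i + coded_structure \<tau> A \<alpha> e
  for j :: "'v::zfc_universe \<Rightarrow> 'v" and M \<kappa> \<eta> \<tau> A D i \<alpha> e +
  assumes \<alpha>_less: "\<alpha> \<in> elts \<eta>"
begin

lemma \<alpha>_\<kappa>: "\<alpha> \<in> elts \<kappa>"
  using \<alpha>_less \<eta>_le_\<kappa> by auto

abbreviation casg :: "('v \<Rightarrow> 'v) \<Rightarrow> 'v" where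
  "casg t \<equiv> restricted_graph \<alpha> (\<lambda>\<beta>. i (t (e \<beta>)))"

lemma j_asgs: "j asgs = fun_set \<alpha> (j (domain A))"
  by (rule j_fun_set[OF \<alpha>_less])

lemma casg_mem: "range t \<subseteq> elts D \<Longrightarrow> casg t \<in> elts (j asgs)"
  unfolding j_asgs using i_mem by (intro fun_set_memI) auto

lemma term_val_ext_mem: "range t \<subseteq> elts D \<Longrightarrow> is_term \<tau> u \<Longrightarrow> term_val ext t u \<in> elts D"
  using term_val_mem[OF is_structure_ext, of t u] by simp

lemma code_vals_mem:
  assumes "range t \<subseteq> elts D" "list_all (is_term \<tau>) us"
  shows "code (map (\<lambda>u. i (term_val ext t u)) us) \<in> elts (j (tuples (length us) (domain A)))"
  using assms term_val_ext_mem i_mem by (auto simp: j_tuples list_all_iff)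

text \<open>Prefixing a value to a tuple is a bounded statement about evaluation graphs and
  transfers. The claim for single terms is a hypothesis, so that the lemma serves inside the
  induction of \<open>j_tval\<close> and also for relation formulas.\<close>

lemma j_tvals:
  assumes t: "range t \<subseteq> elts D"
    and IH: "\<And>u. u \<in> set us \<Longrightarrow> opair (casg t) (i (term_val ext t u)) \<in> elts (j (tval u))"
    and us: "list_all (is_term \<tau>) us" "\<Union> (tvars ` set us) \<subseteq> e ` elts \<alpha>"
  shows "opair (casg t) (code (map (\<lambda>u. i (term_val ext t u)) us)) \<in> elts (j (tvals us))"
  using IH us
proof (induction us)
  case Nil
  have "fo_definable (\<lambda>M (s::nat \<Rightarrow> 'v). \<forall>g\<in>elts (s 0). opair g (s 1) \<in> elts (s 2))"
    by ((rule fo_definable_basic | (rule fo_definable_bounded, (simp; fail)))+)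
  note tr = transfer[OF this, of "(!) [asgs, set_of {}, tvals []]"]
  have "\<forall>g\<in>elts asgs. opair g (set_of {}) \<in> elts (tvals [])"
    by (auto simp: elts_tvals elim!: asg_cases)
  with tr have "\<forall>g\<in>elts (j asgs). opair g (set_of {}) \<in> elts (j (tvals []))"
    by (simp add: j_empty)
  then show ?case using casg_mem[OF t] by simp
next
  case (Cons u us)
  let ?C = "tuples (length us) (domain A)" and ?C' = "tuples (Suc (length us)) (domain A)"
  \<comment> \<open>The variable \<open>d\<close> names the inner pair, so that the nested pair fits
    the definability rules.\<close>
  have "fo_definable (\<lambda>M (s::nat \<Rightarrow> 'v). \<forall>g\<in>elts (s 0). \<forall>y\<in>elts (s 1). \<forall>c\<in>elts (s 2). \<forall>d\<in>elts (s 3).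
      opair g y \<in> elts (s 4) \<and> opair g c \<in> elts (s 5) \<and> d = opair y c \<longrightarrow> opair g d \<in> elts (s 6))"
    by ((rule fo_definable_basic | (rule fo_definable_bounded, (simp; fail)))+)
  note tr = transfer[OF this,
      of "(!) [asgs, domain A, ?C, ?C', tval u, tvals us, tvals (u # us)]"]
  have "\<forall>g\<in>elts asgs. \<forall>y\<in>elts (domain A). \<forall>c\<in>elts ?C. \<forall>d\<in>elts ?C'.
      opair g y \<in> elts (tval u) \<and> opair g c \<in> elts (tvals us) \<and> d = opair y c \<longrightarrow>
      opair g d \<in> elts (tvals (u # us))"
    using Cons.prems by (auto simp: tval_opair_iff tvals_opair_iff elim!: asg_cases)
  with tr have H: "\<forall>g\<in>elts (j asgs). \<forall>y\<in>elts (j (domain A)). \<forall>c\<in>elts (j ?C). \<forall>d\<in>elts (j ?C').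
      opair g y \<in> elts (j (tval u)) \<and> opair g c \<in> elts (j (tvals us)) \<and> d = opair y c \<longrightarrow>
      opair g d \<in> elts (j (tvals (u # us)))"
    by simp
  let ?v = "\<lambda>u. i (term_val ext t u)"
  have "opair (casg t) (code (map ?v us)) \<in> elts (j (tvals us))"
    by (rule Cons.IH) (use Cons.prems in auto)
  moreover have "opair (casg t) (?v u) \<in> elts (j (tval u))" using Cons.prems by simp
  moreover have "code (map ?v us) \<in> elts (j ?C)"
    by (rule code_vals_mem[OF t]) (use Cons.prems in simp)
  moreover have "code (map ?v (u # us)) \<in> elts (j ?C')"
    using code_vals_mem[OF t Cons.prems(2)] by (simp only: list.size add_Suc_right add_0_right)
  moreover have "?v u \<in> elts (j (domain A))"
    using Cons.prems(2) term_val_ext_mem[OF t] i_mem by simp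
  ultimately show ?case using H casg_mem[OF t] by simp
qed

text \<open>Looking up a variable and applying a function symbol are bounded statements about
  evaluation graphs, so the recursive computation of a term transfers.\<close>

lemma j_tval:
  assumes t: "range t \<subseteq> elts D"
  shows "is_term \<tau> u \<Longrightarrow> tvars u \<subseteq> e ` elts \<alpha> \<Longrightarrow>
    opair (casg t) (i (term_val ext t u)) \<in> elts (j (tval u))"
proof (induction u)
  case (Var v)
  \<comment> \<open>The variable is replaced by its index, which \<open>j\<close> fixes as a member
    of \<alpha>.\<close>
  then obtain \<beta> where \<beta>: "\<beta> \<in> elts \<alpha>" "v = e \<beta>" by auto
  have "fo_definable (\<lambda>M (s::nat \<Rightarrow> 'v). \<forall>g\<in>elts (s 0). \<forall>y\<in>elts (s 1).
      opair (s 2) y \<in> elts g \<longrightarrow> opair g y \<in> elts (s 3))"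
    by ((rule fo_definable_basic | (rule fo_definable_bounded, (simp; fail)))+)
  note tr = transfer[OF this, of "(!) [asgs, domain A, \<beta>, tval (Var v)]"]
  have "\<forall>g\<in>elts asgs. \<forall>y\<in>elts (domain A). opair \<beta> y \<in> elts g \<longrightarrow> opair g y \<in> elts (tval (Var v))"
    using \<beta> by (auto simp: tval_opair_iff elim!: asg_cases)
  with tr have "\<forall>g\<in>elts (j asgs). \<forall>y\<in>elts (j (domain A)).
      opair \<beta> y \<in> elts g \<longrightarrow> opair g y \<in> elts (j (tval (Var v)))"
    by (simp add: \<kappa>_elts_fixed[OF \<alpha>_\<kappa> \<beta>(1)])
  moreover have "i (t v) \<in> elts (j (domain A))" using t by (intro i_mem) auto
  ultimately show ?case using casg_mem[OF t] \<beta> by simp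
next
  case (App f us)
  let ?C = "tuples (length us) (domain A)" and ?u = "App f us"
  have us: "list_all (is_term \<tau>) us" "\<Union> (tvars ` set us) \<subseteq> e ` elts \<alpha>"
    and f: "f \<in> elts (fun_syms \<tau>)" "length us = fun_arity \<tau> f"
    using App.prems by (auto simp: list_all_iff)
  have "fo_definable (\<lambda>M (s::nat \<Rightarrow> 'v). \<forall>g\<in>elts (s 0). \<forall>c\<in>elts (s 1). \<forall>y\<in>elts (s 2).
      opair g c \<in> elts (s 3) \<and> opair c y \<in> elts (s 4) \<longrightarrow> opair g y \<in> elts (s 5))"
    by ((rule fo_definable_basic | (rule fo_definable_bounded, (simp; fail)))+)
  note tr = transfer[OF this,
      of "(!) [asgs, ?C, domain A, tvals us, fun_code \<tau> A f, tval ?u]"]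
  have "\<forall>g\<in>elts asgs. \<forall>c\<in>elts ?C. \<forall>y\<in>elts (domain A).
      opair g c \<in> elts (tvals us) \<and> opair c y \<in> elts (fun_code \<tau> A f) \<longrightarrow> opair g y \<in> elts (tval ?u)"
  proof (intro ballI impI)
    fix g c y assume "g \<in> elts asgs"
    then obtain s where s: "g = asg s" "range s \<subseteq> elts (domain A)" by (rule asg_cases)
    assume *: "opair g c \<in> elts (tvals us) \<and> opair c y \<in> elts (fun_code \<tau> A f)"
    then have c: "c = code (map (term_val A s) us)" using s us by (simp add: tvals_opair_iff)
    then have "y = term_val A s ?u" using * unfolding elts_fun_code by (auto simp del: map_eq_conv)
    then show "opair g y \<in> elts (tval ?u)" using App.prems s by (simp add: tval_opair_iff)
  qed
  with tr have H: "\<forall>g\<in>elts (j asgs). \<forall>c\<in>elts (j ?C). \<forall>y\<in>elts (j (domain A)).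
      opair g c \<in> elts (j (tvals us)) \<and> opair c y \<in> elts (j (fun_code \<tau> A f)) \<longrightarrow>
      opair g y \<in> elts (j (tval ?u))"
    by simp
  have IH: "opair (casg t) (i (term_val ext t u)) \<in> elts (j (tval u))" if "u \<in> set us" for u
    by (rule App.IH[OF that]) (use us that in \<open>auto simp: list_all_iff\<close>)
  have "set (map (term_val ext t) us) \<subseteq> elts D" using us(1) term_val_ext_mem[OF t] by (auto simp: list_all_iff)
  from fun_int_ext(2)[OF f(1) this] f(2)
  have "opair (code (map (\<lambda>u. i (term_val ext t u)) us)) (i (term_val ext t ?u)) \<in> elts (j (fun_code \<tau> A f))"
    by (simp add: o_def)
  moreover note j_tvals[OF t IH us]
  moreover have "i (term_val ext t ?u) \<in> elts (j (domain A))"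
    by (rule i_mem[OF term_val_ext_mem[OF t App.prems(1)]])
  ultimately show ?case using H casg_mem[OF t] code_vals_mem[OF t us(1)] by blast
qed

end

section \<open>Satisfaction under the embedding\<close>

context coded_embedding
begin

lemma subset_code:
  obtains x where "elts x = {\<beta> \<in> elts \<alpha>. e \<beta> \<in> X}" "j x = x"
proof -
  obtain x where x: "elts x = {\<beta> \<in> elts \<alpha>. e \<beta> \<in> X}"
    using separation[of "{\<beta> \<in> elts \<alpha>. e \<beta> \<in> X}" \<alpha>] by auto
  moreover have "j x = x" by (rule j_subset_fixed[OF \<alpha>_\<kappa>]) (use x in auto)
  ultimately show ?thesis by (rule that)
qed

text \<open>The index class has the size of some \<beta> below \<eta>, hence below \<kappa>, so
  \<open>j\<close> acts pointwise on the family by \<open>elts_j_small\<close>.\<close>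

lemma family_code:
  fixes I :: "'v set" and F :: "'v \<Rightarrow> 'v"
  assumes "I \<prec> elts \<eta>"
  obtains q where "elts q = F ` I" "elts (j q) = (\<lambda>i. j (F i)) ` I"
proof -
  have "Card \<eta>" using regular by (simp add: regular_card_def)
  then obtain \<beta> where \<beta>: "\<beta> \<in> elts \<eta>" "I \<approx> elts \<beta>" using assms by (rule lesspoll_Card_eqpoll)
  from eqpoll_sym[OF \<beta>(2)] obtain h where h: "bij_betw h (elts \<beta>) I" unfolding eqpoll_def by auto
  then have I: "I = h ` elts \<beta>" by (simp add: bij_betw_imp_surj_on)
  have "elts (set_of (F ` I)) = F ` I"
    unfolding I by (intro elts_set_of small_image small_elts)
  then obtain q where q: "elts q = F ` I" by blast
  have "elts (j q) = j ` elts q"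
    by (rule elts_j_small[of \<beta> _ "\<lambda>b. F (h b)"]) (use \<beta>(1) \<eta>_le_\<kappa> q I in auto)
  then show ?thesis using q by (intro that[of q]) (simp_all add: image_image)
qed

text \<open>Each case states how the satisfaction set arises from evaluation graphs or from
  satisfaction sets of subformulas, proves this in \<open>A\<close>, transfers it, and instantiates
  the result at \<open>casg t\<close>. The assignment is arbitrary because quantifiers override
  it.\<close>

lemma L_sat_ext:
  "L_form \<eta> \<tau> \<phi> \<Longrightarrow> allvars \<phi> \<subseteq> e ` elts \<alpha> \<Longrightarrow> range t \<subseteq> elts D \<Longrightarrow>
    casg t \<in> elts (j (sat \<phi>)) \<longleftrightarrow> L_sat ext t \<phi>"
proof (induction \<phi> arbitrary: t)
  case (EqF u w)
  have "fo_definable (\<lambda>M (s::nat \<Rightarrow> 'v). \<forall>g\<in>elts (s 0). \<forall>y\<in>elts (s 1). \<forall>z\<in>elts (s 1).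
      opair g y \<in> elts (s 2) \<and> opair g z \<in> elts (s 3) \<longrightarrow> (g \<in> elts (s 4) \<longleftrightarrow> y = z))"
    by ((rule fo_definable_basic | (rule fo_definable_bounded, (simp; fail)))+)
  note tr = transfer[OF this, of "(!) [asgs, domain A, tval u, tval w, sat (EqF u w)]"]
  have "\<forall>g\<in>elts asgs. \<forall>y\<in>elts (domain A). \<forall>z\<in>elts (domain A).
      opair g y \<in> elts (tval u) \<and> opair g z \<in> elts (tval w) \<longrightarrow>
      (g \<in> elts (sat (EqF u w)) \<longleftrightarrow> y = z)"
  proof (intro ballI impI)
    fix g y z assume "g \<in> elts asgs"
    then obtain s where s: "g = asg s" "range s \<subseteq> elts (domain A)" by (rule asg_cases)
    assume "opair g y \<in> elts (tval u) \<and> opair g z \<in> elts (tval w)"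
    then have "y = term_val A s u" "z = term_val A s w"
      using EqF.prems s by (simp_all add: tval_opair_iff)
    then show "g \<in> elts (sat (EqF u w)) \<longleftrightarrow> y = z"
      unfolding s(1) asg_mem_sat[OF s(2) EqF.prems(2)] by simp
  qed
  with tr have "\<forall>g\<in>elts (j asgs). \<forall>y\<in>elts (j (domain A)). \<forall>z\<in>elts (j (domain A)).
      opair g y \<in> elts (j (tval u)) \<and> opair g z \<in> elts (j (tval w)) \<longrightarrow>
      (g \<in> elts (j (sat (EqF u w))) \<longleftrightarrow> y = z)"
    by simp
  moreover have mem: "term_val ext t u \<in> elts D" "term_val ext t w \<in> elts D"
    using term_val_ext_mem[OF EqF.prems(3)] EqF.prems(1) by simp_all
  moreover have "opair (casg t) (i (term_val ext t u)) \<in> elts (j (tval u))"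
    "opair (casg t) (i (term_val ext t w)) \<in> elts (j (tval w))"
    using j_tval[OF EqF.prems(3)] EqF.prems(1,2) by simp_all
  ultimately have "casg t \<in> elts (j (sat (EqF u w))) \<longleftrightarrow>
      i (term_val ext t u) = i (term_val ext t w)"
    using casg_mem[OF EqF.prems(3)] i_mem by blast
  also have "\<dots> \<longleftrightarrow> term_val ext t u = term_val ext t w"
    using mem bij_betw_imp_inj_on[OF bij_i] by (auto dest: inj_onD)
  finally show ?case by simp
next
  case (RelF r us)
  let ?C = "tuples (length us) (domain A)" and ?\<phi> = "RelF r us"
  have us: "list_all (is_term \<tau>) us" "\<Union> (tvars ` set us) \<subseteq> e ` elts \<alpha>"
    and r: "r \<in> elts (rel_syms \<tau>)" "length us = rel_arity \<tau> r"
    using RelF.prems by auto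
  have "fo_definable (\<lambda>M (s::nat \<Rightarrow> 'v). \<forall>g\<in>elts (s 0). \<forall>c\<in>elts (s 1).
      opair g c \<in> elts (s 2) \<longrightarrow> (g \<in> elts (s 3) \<longleftrightarrow> c \<in> elts (s 4)))"
    by ((rule fo_definable_basic | (rule fo_definable_bounded, (simp; fail)))+)
  note tr = transfer[OF this, of "(!) [asgs, ?C, tvals us, sat ?\<phi>, rel_code \<tau> A r]"]
  have "\<forall>g\<in>elts asgs. \<forall>c\<in>elts ?C.
      opair g c \<in> elts (tvals us) \<longrightarrow> (g \<in> elts (sat ?\<phi>) \<longleftrightarrow> c \<in> elts (rel_code \<tau> A r))"
  proof (intro ballI impI)
    fix g c assume "g \<in> elts asgs"
    then obtain s where s: "g = asg s" "range s \<subseteq> elts (domain A)" by (rule asg_cases)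
    assume "opair g c \<in> elts (tvals us)"
    then have c: "c = code (map (term_val A s) us)" using s us by (simp add: tvals_opair_iff)
    have "map (term_val A s) us \<in> lists (elts (domain A))"
      using term_val_mem[OF A_structure s(2)] us(1) by (auto simp: list_all_iff)
    then have "c \<in> elts (rel_code \<tau> A r) \<longleftrightarrow> rel_int A r (map (term_val A s) us)"
      using r(2) unfolding c elts_rel_code by (auto simp del: map_eq_conv)
    then show "g \<in> elts (sat ?\<phi>) \<longleftrightarrow> c \<in> elts (rel_code \<tau> A r)"
      unfolding s(1) asg_mem_sat[OF s(2) RelF.prems(2)] by simp
  qed
  with tr have "\<forall>g\<in>elts (j asgs). \<forall>c\<in>elts (j ?C). opair g c \<in> elts (j (tvals us)) \<longrightarrow>
      (g \<in> elts (j (sat ?\<phi>)) \<longleftrightarrow> c \<in> elts (j (rel_code \<tau> A r)))"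
    by simp
  moreover have "opair (casg t) (code (map (\<lambda>u. i (term_val ext t u)) us)) \<in> elts (j (tvals us))"
    by (rule j_tvals[OF RelF.prems(3) _ us], rule j_tval[OF RelF.prems(3)])
      (use us in \<open>auto simp: list_all_iff\<close>)
  ultimately have "casg t \<in> elts (j (sat ?\<phi>)) \<longleftrightarrow>
      code (map (\<lambda>u. i (term_val ext t u)) us) \<in> elts (j (rel_code \<tau> A r))"
    using casg_mem[OF RelF.prems(3)] code_vals_mem[OF RelF.prems(3) us(1)] by blast
  then show ?case by (simp add: ext_def o_def)
next
  case (NegF \<phi>)
  have "fo_definable (\<lambda>M (s::nat \<Rightarrow> 'v). \<forall>g\<in>elts (s 0). g \<in> elts (s 1) \<longleftrightarrow> \<not> g \<in> elts (s 2))"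
    by ((rule fo_definable_basic | (rule fo_definable_bounded, (simp; fail)))+)
  note tr = transfer[OF this, of "(!) [asgs, sat (NegF \<phi>), sat \<phi>]"]
  have "\<forall>g\<in>elts asgs. g \<in> elts (sat (NegF \<phi>)) \<longleftrightarrow> \<not> g \<in> elts (sat \<phi>)"
    using NegF.prems by (auto simp: asg_mem_sat elim!: asg_cases)
  with tr have "\<forall>g\<in>elts (j asgs). g \<in> elts (j (sat (NegF \<phi>))) \<longleftrightarrow> \<not> g \<in> elts (j (sat \<phi>))"
    by simp
  then show ?case using NegF casg_mem[OF NegF.prems(3)] by simp
next
  case (ConjF I \<Phi>)
  have "I \<prec> elts \<eta>" using ConjF.prems by simp
  \<comment> \<open>The members of \<open>j q\<close> are indexed by the same \<open>I\<close>, so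
    the transferred quantifier runs over the original conjuncts.\<close>
  then obtain q where q: "elts q = (\<lambda>i. sat (\<Phi> i)) ` I"
    "elts (j q) = (\<lambda>i. j (sat (\<Phi> i))) ` I"
    by (rule family_code)
  have "fo_definable (\<lambda>M (s::nat \<Rightarrow> 'v). \<forall>g\<in>elts (s 0). g \<in> elts (s 1) \<longleftrightarrow> (\<forall>x\<in>elts (s 2). g \<in> elts x))"
    by ((rule fo_definable_basic | (rule fo_definable_bounded, (simp; fail)))+)
  note tr = transfer[OF this, of "(!) [asgs, sat (ConjF I \<Phi>), q]"]
  have "\<forall>g\<in>elts asgs. g \<in> elts (sat (ConjF I \<Phi>)) \<longleftrightarrow> (\<forall>x\<in>elts q. g \<in> elts x)"
  proof
    fix g assume "g \<in> elts asgs"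
    then obtain s where s: "g = asg s" "range s \<subseteq> elts (domain A)" by (rule asg_cases)
    have "asg s \<in> elts (sat (\<Phi> i)) \<longleftrightarrow> L_sat A s (\<Phi> i)" if "i \<in> I" for i
      using ConjF.prems(2) that by (intro asg_mem_sat[OF s(2)]) auto
    then show "g \<in> elts (sat (ConjF I \<Phi>)) \<longleftrightarrow> (\<forall>x\<in>elts q. g \<in> elts x)"
      unfolding s(1) asg_mem_sat[OF s(2) ConjF.prems(2)] q(1) by simp
  qed
  with tr have "\<forall>g\<in>elts (j asgs). g \<in> elts (j (sat (ConjF I \<Phi>))) \<longleftrightarrow> (\<forall>x\<in>elts (j q). g \<in> elts x)"
    by simp
  moreover have "casg t \<in> elts (j (sat (\<Phi> i))) \<longleftrightarrow> L_sat ext t (\<Phi> i)" if "i \<in> I" for i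
    by (rule ConjF.IH) (use ConjF.prems that in auto)
  ultimately show ?case using casg_mem[OF ConjF.prems(3)] unfolding q(2) by simp
next
  case (DisjF I \<Phi>)
  have "I \<prec> elts \<eta>" using DisjF.prems by simp
  then obtain q where q: "elts q = (\<lambda>i. sat (\<Phi> i)) ` I"
    "elts (j q) = (\<lambda>i. j (sat (\<Phi> i))) ` I"
    by (rule family_code)
  have "fo_definable (\<lambda>M (s::nat \<Rightarrow> 'v). \<forall>g\<in>elts (s 0). g \<in> elts (s 1) \<longleftrightarrow> (\<exists>x\<in>elts (s 2). g \<in> elts x))"
    by ((rule fo_definable_basic | (rule fo_definable_bounded, (simp; fail)))+)
  note tr = transfer[OF this, of "(!) [asgs, sat (DisjF I \<Phi>), q]"]
  have "\<forall>g\<in>elts asgs. g \<in> elts (sat (DisjF I \<Phi>)) \<longleftrightarrow> (\<exists>x\<in>elts q. g \<in> elts x)"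
  proof
    fix g assume "g \<in> elts asgs"
    then obtain s where s: "g = asg s" "range s \<subseteq> elts (domain A)" by (rule asg_cases)
    have "asg s \<in> elts (sat (\<Phi> i)) \<longleftrightarrow> L_sat A s (\<Phi> i)" if "i \<in> I" for i
      using DisjF.prems(2) that by (intro asg_mem_sat[OF s(2)]) auto
    then show "g \<in> elts (sat (DisjF I \<Phi>)) \<longleftrightarrow> (\<exists>x\<in>elts q. g \<in> elts x)"
      unfolding s(1) asg_mem_sat[OF s(2) DisjF.prems(2)] q(1) by simp
  qed
  with tr have "\<forall>g\<in>elts (j asgs). g \<in> elts (j (sat (DisjF I \<Phi>))) \<longleftrightarrow> (\<exists>x\<in>elts (j q). g \<in> elts x)"
    by simp
  moreover have "casg t \<in> elts (j (sat (\<Phi> i))) \<longleftrightarrow> L_sat ext t (\<Phi> i)" if "i \<in> I" for i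
    by (rule DisjF.IH) (use DisjF.prems that in auto)
  ultimately show ?case using casg_mem[OF DisjF.prems(3)] unfolding q(2) by simp
next
  case (ExF X \<phi>)
  have X: "X \<subseteq> e ` elts \<alpha>" and \<phi>: "L_form \<eta> \<tau> \<phi>" "allvars \<phi> \<subseteq> e ` elts \<alpha>"
    using ExF.prems by auto
  obtain x where x: "elts x = {\<beta> \<in> elts \<alpha>. e \<beta> \<in> X}" "j x = x" by (rule subset_code)
  \<comment> \<open>Here \<open>h\<close> is a variant of \<open>g\<close>: the two agree at all
    indices outside \<open>x\<close>, the index set of the quantified block.\<close>
  have "fo_definable (\<lambda>M (s::nat \<Rightarrow> 'v). \<forall>g\<in>elts (s 0). g \<in> elts (s 1) \<longleftrightarrow>
      (\<exists>h\<in>elts (s 0). h \<in> elts (s 2) \<and> (\<forall>b\<in>elts (s 3). \<not> b \<in> elts (s 4) \<longrightarrow>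
        (\<forall>y\<in>elts (s 5). opair b y \<in> elts h \<longleftrightarrow> opair b y \<in> elts g))))"
    by ((rule fo_definable_basic | (rule fo_definable_bounded, (simp; fail)))+)
  note tr = transfer[OF this, of "(!) [asgs, sat (ExF X \<phi>), sat \<phi>, \<alpha>, x, domain A]"]
  have "\<forall>g\<in>elts asgs. g \<in> elts (sat (ExF X \<phi>)) \<longleftrightarrow>
      (\<exists>h\<in>elts asgs. h \<in> elts (sat \<phi>) \<and> (\<forall>b\<in>elts \<alpha>. \<not> b \<in> elts x \<longrightarrow>
        (\<forall>y\<in>elts (domain A). opair b y \<in> elts h \<longleftrightarrow> opair b y \<in> elts g)))"
  proof
    fix g assume "g \<in> elts asgs"
    then obtain s where s: "g = asg s" "range s \<subseteq> elts (domain A)" by (rule asg_cases)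
    have "L_sat A (override_on s u X) \<phi> \<longleftrightarrow> asg (override_on s u X) \<in> elts (sat \<phi>)"
      if "u ` X \<subseteq> elts (domain A)" for u
    proof -
      have "override_on s u X v \<in> elts (domain A)" for v using that s(2) by (cases "v \<in> X") auto
      then have "range (override_on s u X) \<subseteq> elts (domain A)" by auto
      from asg_mem_sat[OF this \<phi>(2)] show ?thesis by simp
    qed
    then have "g \<in> elts (sat (ExF X \<phi>)) \<longleftrightarrow>
      (\<exists>u. u ` X \<subseteq> elts (domain A) \<and> asg (override_on s u X) \<in> elts (sat \<phi>))"
      unfolding s(1) asg_mem_sat[OF s(2) ExF.prems(2)] by auto
    \<comment> \<open>In \<open>A\<close> the values of assignments already lie in the domain, so
      the bijection is the identity; for \<open>ext\<close> it is \<open>i\<close>.\<close>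
    also note ex_override_iff[OF bij_betw_id[unfolded id_def] inj_e s(2) X x(1), of "\<lambda>g. g \<in> elts (sat \<phi>)"]
    finally show "g \<in> elts (sat (ExF X \<phi>)) \<longleftrightarrow>
      (\<exists>h\<in>elts asgs. h \<in> elts (sat \<phi>) \<and> (\<forall>b\<in>elts \<alpha>. \<not> b \<in> elts x \<longrightarrow>
        (\<forall>y\<in>elts (domain A). opair b y \<in> elts h \<longleftrightarrow> opair b y \<in> elts g)))"
      unfolding s(1) .
  qed
  with tr have H: "\<forall>g\<in>elts (j asgs). g \<in> elts (j (sat (ExF X \<phi>))) \<longleftrightarrow>
      (\<exists>h\<in>elts (j asgs). h \<in> elts (j (sat \<phi>)) \<and> (\<forall>b\<in>elts \<alpha>. \<not> b \<in> elts x \<longrightarrow>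
        (\<forall>y\<in>elts (j (domain A)). opair b y \<in> elts h \<longleftrightarrow> opair b y \<in> elts g)))"
    by (simp add: x(2) \<kappa>_fixed[OF \<alpha>_\<kappa>])
  have IH: "casg (override_on t u X) \<in> elts (j (sat \<phi>)) \<longleftrightarrow> L_sat ext (override_on t u X) \<phi>"
    if "u ` X \<subseteq> elts D" for u
  proof -
    have "override_on t u X v \<in> elts D" for v using that ExF.prems(3) by (cases "v \<in> X") auto
    then have "range (override_on t u X) \<subseteq> elts D" by auto
    from ExF.IH[OF \<phi> this] show ?thesis .
  qed
  have "L_sat ext t (ExF X \<phi>) \<longleftrightarrow>
      (\<exists>u. u ` X \<subseteq> elts D \<and> casg (override_on t u X) \<in> elts (j (sat \<phi>)))"
    using IH by auto
  also note ex_override_iff[OF bij_i inj_e ExF.prems(3) X x(1), of "\<lambda>g. g \<in> elts (j (sat \<phi>))"]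
  finally show ?case using H[unfolded j_asgs] casg_mem[OF ExF.prems(3), unfolded j_asgs] by simp
next
  case (AllF X \<phi>)
  have X: "X \<subseteq> e ` elts \<alpha>" and \<phi>: "L_form \<eta> \<tau> \<phi>" "allvars \<phi> \<subseteq> e ` elts \<alpha>"
    using AllF.prems by auto
  obtain x where x: "elts x = {\<beta> \<in> elts \<alpha>. e \<beta> \<in> X}" "j x = x" by (rule subset_code)
  \<comment> \<open>The universal quantifier is treated through its negation, so that the
    existential description of variants can be reused.\<close>
  have "fo_definable (\<lambda>M (s::nat \<Rightarrow> 'v). \<forall>g\<in>elts (s 0). \<not> g \<in> elts (s 1) \<longleftrightarrow>
      (\<exists>h\<in>elts (s 0). \<not> h \<in> elts (s 2) \<and> (\<forall>b\<in>elts (s 3). \<not> b \<in> elts (s 4) \<longrightarrow>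
        (\<forall>y\<in>elts (s 5). opair b y \<in> elts h \<longleftrightarrow> opair b y \<in> elts g))))"
    by ((rule fo_definable_basic | (rule fo_definable_bounded, (simp; fail)))+)
  note tr = transfer[OF this, of "(!) [asgs, sat (AllF X \<phi>), sat \<phi>, \<alpha>, x, domain A]"]
  have "\<forall>g\<in>elts asgs. \<not> g \<in> elts (sat (AllF X \<phi>)) \<longleftrightarrow>
      (\<exists>h\<in>elts asgs. \<not> h \<in> elts (sat \<phi>) \<and> (\<forall>b\<in>elts \<alpha>. \<not> b \<in> elts x \<longrightarrow>
        (\<forall>y\<in>elts (domain A). opair b y \<in> elts h \<longleftrightarrow> opair b y \<in> elts g)))"
  proof
    fix g assume "g \<in> elts asgs"
    then obtain s where s: "g = asg s" "range s \<subseteq> elts (domain A)" by (rule asg_cases)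
    have "L_sat A (override_on s u X) \<phi> \<longleftrightarrow> asg (override_on s u X) \<in> elts (sat \<phi>)"
      if "u ` X \<subseteq> elts (domain A)" for u
    proof -
      have "override_on s u X v \<in> elts (domain A)" for v using that s(2) by (cases "v \<in> X") auto
      then have "range (override_on s u X) \<subseteq> elts (domain A)" by auto
      from asg_mem_sat[OF this \<phi>(2)] show ?thesis by simp
    qed
    then have "\<not> g \<in> elts (sat (AllF X \<phi>)) \<longleftrightarrow>
      (\<exists>u. u ` X \<subseteq> elts (domain A) \<and> \<not> asg (override_on s u X) \<in> elts (sat \<phi>))"
      unfolding s(1) asg_mem_sat[OF s(2) AllF.prems(2)] by auto
    also note ex_override_iff[OF bij_betw_id[unfolded id_def] inj_e s(2) X x(1), of "\<lambda>g. \<not> g \<in> elts (sat \<phi>)"]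
    finally show "\<not> g \<in> elts (sat (AllF X \<phi>)) \<longleftrightarrow>
      (\<exists>h\<in>elts asgs. \<not> h \<in> elts (sat \<phi>) \<and> (\<forall>b\<in>elts \<alpha>. \<not> b \<in> elts x \<longrightarrow>
        (\<forall>y\<in>elts (domain A). opair b y \<in> elts h \<longleftrightarrow> opair b y \<in> elts g)))"
      unfolding s(1) .
  qed
  with tr have H: "\<forall>g\<in>elts (j asgs). \<not> g \<in> elts (j (sat (AllF X \<phi>))) \<longleftrightarrow>
      (\<exists>h\<in>elts (j asgs). \<not> h \<in> elts (j (sat \<phi>)) \<and> (\<forall>b\<in>elts \<alpha>. \<not> b \<in> elts x \<longrightarrow>
        (\<forall>y\<in>elts (j (domain A)). opair b y \<in> elts h \<longleftrightarrow> opair b y \<in> elts g)))"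
    by (simp add: x(2) \<kappa>_fixed[OF \<alpha>_\<kappa>])
  have IH: "casg (override_on t u X) \<in> elts (j (sat \<phi>)) \<longleftrightarrow> L_sat ext (override_on t u X) \<phi>"
    if "u ` X \<subseteq> elts D" for u
  proof -
    have "override_on t u X v \<in> elts D" for v using that AllF.prems(3) by (cases "v \<in> X") auto
    then have "range (override_on t u X) \<subseteq> elts D" by auto
    from AllF.IH[OF \<phi> this] show ?thesis .
  qed
  have "\<not> L_sat ext t (AllF X \<phi>) \<longleftrightarrow>
      (\<exists>u. u ` X \<subseteq> elts D \<and> \<not> casg (override_on t u X) \<in> elts (j (sat \<phi>)))"
    using IH by auto
  also note ex_override_iff[OF bij_i inj_e AllF.prems(3) X x(1), of "\<lambda>g. \<not> g \<in> elts (j (sat \<phi>))"]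
  also note bspec[OF H[unfolded j_asgs] casg_mem[OF AllF.prems(3), unfolded j_asgs], symmetric]
  finally show ?case by blast
qed

text \<open>For an assignment into \<open>A\<close> the code \<open>casg s\<close> equals
  \<open>j (asg s)\<close>, and \<open>j_mem\<close> reduces membership in
  \<open>j (sat \<phi>)\<close> to membership in \<open>sat \<phi>\<close>.\<close>

lemma L_sat_iff_ext:
  assumes "L_form \<eta> \<tau> \<phi>" "allvars \<phi> \<subseteq> e ` elts \<alpha>" and s: "range s \<subseteq> elts (domain A)"
  shows "L_sat A s \<phi> \<longleftrightarrow> L_sat ext s \<phi>"
proof -
  have "casg s = j (asg s)"
    unfolding j_restricted_graph[OF \<alpha>_\<kappa>] restricted_graph_eq_iff using s i_eq_j by auto
  then have "casg s \<in> elts (j (sat \<phi>)) \<longleftrightarrow> L_sat A s \<phi>"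
    using asg_mem_sat[OF s assms(2)] by simp
  moreover have "range s \<subseteq> elts D" using s A_sub_D by auto
  ultimately show ?thesis using L_sat_ext[OF assms(1,2)] by simp
qed

end

text \<open>The ordinal \<alpha> and the enumeration \<open>e\<close> depend on the formula, so
  \<open>coded_embedding\<close> is interpreted separately for each \<phi>.\<close>

lemma (in structure_embedding) L_elementary_sub_ext: "L_elementary_sub \<eta> \<tau> A ext"
  unfolding L_elementary_sub_def
proof (intro conjI substructure_ext allI impI)
  fix \<phi> and s :: "'v \<Rightarrow> 'v"
  assume \<phi>: "L_form \<eta> \<tau> \<phi> \<and> range s \<subseteq> elts (domain A)"
  have "Card \<eta>" using regular by (simp add: regular_card_def)
  moreover have "allvars \<phi> \<prec> elts \<eta>" using allvars_lesspoll[OF regular] \<phi> by blast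
  ultimately obtain \<alpha> where \<alpha>: "\<alpha> \<in> elts \<eta>" "allvars \<phi> \<approx> elts \<alpha>" by (rule lesspoll_Card_eqpoll)
  from eqpoll_sym[OF \<alpha>(2)] obtain e where e: "bij_betw e (elts \<alpha>) (allvars \<phi>)"
    unfolding eqpoll_def by auto
  interpret coded_embedding j M \<kappa> \<eta> \<tau> A D i \<alpha> e
    by unfold_locales (use A_structure \<alpha>(1) e in \<open>auto simp: bij_betw_def\<close>)
  show "L_sat A s \<phi> \<longleftrightarrow> L_sat ext s \<phi>"
    using L_sat_iff_ext \<phi> e by (simp add: bij_betw_def)
qed

section \<open>The isomorphic copy and the size of the target\<close>

lemma extend_injection:
  fixes j :: "'v::zfc_universe \<Rightarrow> 'v"
  assumes j: "inj_on j (elts a)" "j ` elts a \<subseteq> elts b"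
  obtains D i where "elts a \<subseteq> elts D" "bij_betw i (elts D) (elts b)" "\<And>x. x \<in> elts a \<Longrightarrow> i x = j x"
proof -
  obtain u where u: "\<And>x. opair u x \<notin> elts a" using exists_fresh by blast
  define R where "R = elts b - j ` elts a"
  \<comment> \<open>Points in the image of \<open>a\<close> return to their preimages, all others
    are tagged with \<open>u\<close>. Tagged points avoid \<open>a\<close>, so \<open>g\<close> is
    injective.\<close>
  define g where "g y = (if y \<in> R then opair u y else inv_into (elts a) j y)" for y
  have "elts (set_of (g ` elts b)) = g ` elts b" by (intro elts_set_of small_image small_elts)
  then obtain D where D: "elts D = g ` elts b" by blast
  have g_j: "g (j x) = x" if "x \<in> elts a" for x
    using that j(1) by (simp add: g_def R_def inv_into_f_f)
  have "inj_on g (elts b)"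
  proof (rule inj_onI)
    fix y z assume yz: "y \<in> elts b" "z \<in> elts b" "g y = g z"
    have *: "w \<in> R \<and> g w = opair u w \<or> w \<notin> R \<and> g w \<in> elts a \<and> w = j (g w)" if "w \<in> elts b" for w
      using that by (auto simp: g_def R_def inv_into_f_f[OF j(1)])
    from *[OF yz(1)] *[OF yz(2)] yz(3) u show "y = z" by (metis opair_inject)
  qed
  then have g: "bij_betw g (elts b) (elts D)" unfolding D by (rule inj_on_imp_bij_betw)
  show ?thesis
  proof (rule that)
    show "elts a \<subseteq> elts D"
    proof
      fix x assume x: "x \<in> elts a"
      then have "g (j x) \<in> elts D" unfolding D using j(2) by auto
      then show "x \<in> elts D" using g_j[OF x] by simp
    qed
    show "bij_betw (inv_into (elts b) g) (elts D) (elts b)" by (rule bij_betw_inv_into[OF g])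
    show "inv_into (elts b) g x = j x" if "x \<in> elts a" for x
      using inv_into_f_f[OF bij_betw_imp_inj_on[OF g], of "j x"] g_j[OF that] j(2) that by auto
  qed
qed

text \<open>The graph of an injection is a total relation in which distinct arguments share no
  value; this is a bounded statement and transfers.\<close>

lemma (in embedding) j_lepoll:
  assumes "elts a \<lesssim> elts b" shows "elts (j a) \<lesssim> elts (j b)"
proof -
  from assms obtain f where f: "inj_on f (elts a)" "f ` elts a \<subseteq> elts b" unfolding lepoll_def by auto
  define g where "g = restricted_graph a f"
  have "fo_definable (\<lambda>M (s::nat \<Rightarrow> 'v). (\<forall>x\<in>elts (s 0). \<exists>y\<in>elts (s 1). opair x y \<in> elts (s 2)) \<and>
    (\<forall>x\<in>elts (s 0). \<forall>z\<in>elts (s 0). \<forall>y\<in>elts (s 1).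
      opair x y \<in> elts (s 2) \<and> opair z y \<in> elts (s 2) \<longrightarrow> x = z))"
    by ((rule fo_definable_basic | (rule fo_definable_bounded, (simp; fail)))+)
  note tr = transfer[OF this, of "(!) [a, b, g]"]
  have "(\<forall>x\<in>elts a. \<exists>y\<in>elts b. opair x y \<in> elts g) \<and>
    (\<forall>x\<in>elts a. \<forall>z\<in>elts a. \<forall>y\<in>elts b. opair x y \<in> elts g \<and> opair z y \<in> elts g \<longrightarrow> x = z)"
    using f by (auto simp: g_def dest: inj_onD)
  with tr have *: "\<forall>x\<in>elts (j a). \<exists>y\<in>elts (j b). opair x y \<in> elts (j g)"
    "\<forall>x\<in>elts (j a). \<forall>z\<in>elts (j a). \<forall>y\<in>elts (j b).
      opair x y \<in> elts (j g) \<and> opair z y \<in> elts (j g) \<longrightarrow> x = z"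
    by simp_all
  \<comment> \<open>Any choice of values from the total relation \<open>j g\<close> is
    injective.\<close>
  from *(1) obtain h where "\<forall>x\<in>elts (j a). h x \<in> elts (j b) \<and> opair x (h x) \<in> elts (j g)" by metis
  with *(2) have "inj_on h (elts (j a))" "h ` elts (j a) \<subseteq> elts (j b)"
    by (auto simp: inj_on_def) metis
  then show ?thesis unfolding lepoll_def by blast
qed

section \<open>From tallness to the bound\<close>

lemma tall_imp_SULST_property:
  fixes \<eta> :: "'v::zfc_universe"
  assumes \<eta>: "regular_card \<eta>" "elts \<eta> \<subseteq> elts \<kappa>" and tall: "tall_pushing_up \<kappa> \<delta> \<eta>"
  shows "SULST_property (L_elementary_sub \<eta>) \<delta>"
  unfolding SULST_property_def
proof (intro allI impI, elim conjE)
  fix \<tau> :: "'v language" and A \<gamma> \<gamma>'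
  assume A: "is_structure \<tau> A" and \<gamma>: "Card \<gamma>" "elts (domain A) \<approx> elts \<gamma>" "elts \<delta> \<subseteq> elts \<gamma>"
    and \<gamma>': "Card \<gamma>'" "\<gamma> \<in> elts \<gamma>'"
  have ord: "Ord \<kappa>" "Ord \<delta>" "Ord \<gamma>" "Ord \<gamma>'" and \<kappa>\<delta>: "elts \<kappa> \<subseteq> elts \<delta>"
    using tall \<gamma> \<gamma>' by (simp_all add: tall_pushing_up_def Card_def)
  \<comment> \<open>From \<kappa> \<le> \<delta> \<le> \<gamma> < \<open>\<gamma>'\<close> it
    follows that tallness may be applied with \<open>\<gamma>'\<close> as the ordinal to be
    exceeded.\<close>
  have "\<kappa> \<in> elts \<gamma> \<or> \<kappa> = \<gamma>" using Ord_subset_iff[OF ord(1,3)] \<kappa>\<delta> \<gamma>(3) by blast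
  then have "\<kappa> \<in> elts \<gamma>'" using Ord_trans[OF ord(4) \<gamma>'(2)] \<gamma>'(2) by auto
  with tall ord(4) obtain j M where jM: "transitive_class M" "elementary_embedding j M"
    "critical_point j \<kappa>" "closed_under_seqs_below \<eta> M" "\<gamma>' \<in> elts (j \<delta>)"
    unfolding tall_pushing_up_def by blast
  interpret closed_embedding j M \<kappa> \<eta>
    by unfold_locales (use jM ord(1) \<eta>(2) in \<open>auto simp: critical_point_def\<close>)
  have "inj_on j (elts (domain A))" "j ` elts (domain A) \<subseteq> elts (j (domain A))"
    by (auto simp: inj_on_def)
  then obtain D i where Di: "elts (domain A) \<subseteq> elts D" "bij_betw i (elts D) (elts (j (domain A)))"
    "\<And>x. x \<in> elts (domain A) \<Longrightarrow> i x = j x"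
    by (rule extend_injection) (rule that)
  interpret structure_embedding j M \<kappa> \<eta> \<tau> A D i
    by unfold_locales (use A \<eta>(1) Di in auto)
  \<comment> \<open>Size of the copy: \<open>\<gamma>'\<close> is included in
    \<open>j \<delta>\<close>, which injects into the domain of \<open>j A\<close> because \<delta>
    injects into that of \<open>A\<close>.\<close>
  have "elts \<gamma>' \<subseteq> elts (j \<delta>)" using j_Ord_trans[OF ord(2)] jM(5) by auto
  then have "elts \<gamma>' \<lesssim> elts (j \<delta>)" by (rule subset_imp_lepoll)
  also have "elts (j \<delta>) \<lesssim> elts (j (domain A))"
    by (rule j_lepoll, rule lepoll_trans2[OF subset_imp_lepoll[OF \<gamma>(3)] eqpoll_sym[OF \<gamma>(2)]])
  also have "elts (j (domain A)) \<approx> elts D"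
    unfolding eqpoll_def using bij_betw_inv_into[OF bij_i] by blast
  finally have "elts \<gamma>' \<lesssim> elts (domain ext)" by simp
  with is_structure_ext L_elementary_sub_ext
  show "\<exists>B. is_structure \<tau> B \<and> elts \<gamma>' \<lesssim> elts (domain B) \<and> L_elementary_sub \<eta> \<tau> A B" by blast
qed

text \<open>A minimal cardinal with the property exists by \<open>Ord_minimal\<close>; linearity of
  ordinals makes it the least one, in particular at most \<delta>.\<close>

lemma is_SULST_exists:
  assumes "Card \<delta>" "SULST_property prec \<delta>"
  shows "\<exists>\<mu>. is_SULST prec \<mu> \<and> elts \<mu> \<subseteq> elts \<delta>"
proof -
  have "Ord \<delta>" using assms(1) by (simp add: Card_def)
  with Ord_minimal[of \<delta> "\<lambda>\<nu>. Card \<nu> \<and> SULST_property prec \<nu>"] assms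
  obtain \<mu> where \<mu>: "Card \<mu>" "SULST_property prec \<mu>"
    "\<forall>\<nu>\<in>elts \<mu>. \<not> (Card \<nu> \<and> SULST_property prec \<nu>)" by auto
  have least: "elts \<mu> \<subseteq> elts \<nu>" if "Card \<nu>" "SULST_property prec \<nu>" for \<nu>
  proof -
    have "Ord \<mu>" "Ord \<nu>" using \<mu>(1) that(1) by (simp_all add: Card_def)
    then show ?thesis using Ord_linear[of \<mu> \<nu>] Ord_subset_iff[of \<mu> \<nu>] \<mu>(3) that by auto
  qed
  then show ?thesis using \<mu> assms unfolding is_SULST_def by blast
qed

theorem theorem8p15:
  fixes \<eta> \<kappa> \<delta> :: "'v::zfc_universe"
  assumes "regular_card \<eta>" and "uncountable (elts \<eta>)"
    and "elts \<eta> \<subseteq> elts \<kappa>"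
    and "elts \<kappa> \<subseteq> elts \<delta>"
    and "tall_pushing_up \<kappa> \<delta> \<eta>"
  shows "\<exists>\<mu>. is_SULST (L_elementary_sub \<eta>) \<mu> \<and> elts \<mu> \<subseteq> elts \<delta>"
proof (rule is_SULST_exists)
  show "Card \<delta>" using assms(5) by (simp add: tall_pushing_up_def)
  show "SULST_property (L_elementary_sub \<eta>) \<delta>"
    by (rule tall_imp_SULST_property[OF assms(1,3,5)])
qed

end
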